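(* Let $p=(p_1,\dots,p_a)$ be a probability vector with all $p_s>0$, and let $Y_{\geq k, n}^{p}$ denote the number of nodes with at least $k$ descendants in a $p$-biased recursive tree of order $n$. Then $$\begin{aligned} \mathrm{Var}(Y_{\geq k, n}^{p}) ={}& \left(\sum_{s=1}^{a} p_s \Big(\sum_{r=s}^{a} p_r \Big)^k\right) \Big[(n-k-1)+ p_1\big(2nk -3k(k+1)\big) \Big] \\ & +2 \sum_{s=2}^{a} p_s \frac{1}{\sum_{u=1}^{s-1} p_u} \left(\sum_{r=s}^{a} p_r \Big( \sum_{t=r}^{a} p_t \Big)^k\right) \left[n-k-1 -(n-2k-1)\Big(\sum_{u=s}^{a} p_u\Big)^k - \frac{1- \big( \sum_{u=s}^{a} p_u\big)^{k}}{1-\sum_{u=s}^{a} p_u} \right]\\ & - \left( \sum_{s=1}^{a} p_s \Big(\sum_{r=s}^{a} p_r \Big)^k \right)^2 \Big[ n(2k+1) - (3k+1)(k+1)\Big]. \end{aligned}$$ Moreover, for fixed $k$, $$\begin{aligned} \lim_{n \to \infty} \frac{\mathrm{Var}(Y_{\geq k, n}^{p})}{n} ={}& \left(\sum_{s=1}^{a} p_s \Big(\sum_{r=s}^{a} p_r \Big)^k\right) \left( 2kp_1 + 1 - (2k+1) \sum_{s=1}^{a} p_s \Big(\sum_{r=s}^{a} p_r \Big)^k \right) \\ &+2 \sum_{s=2}^{a} \frac{p_s}{\sum_{u=1}^{s-1} p_u} \left(\sum_{r=s}^{a} p_r \Big( \sum_{t=r}^{a} p_t \Big)^k\right) \left[1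 -\Big(\sum_{u=s}^{a} p_u\Big)^k \right]. \end{aligned}$$
   Context: $p$-biased riffle shuffle of $\{2,\dots,n\}$: start with the deck $2,3,\dots,n$ in increasing order; cut it into $a$ consecutive piles whose sizes $(b_1,\dots,b_a)$ (pile 1 consisting of the $b_1$ smallest cards, etc.) have the multinomial$(n-1;p)$ distribution; then choose uniformly one of the $\binom{n-1}{b_1,\dots,b_a}$ ways of interleaving the piles keeping the cards of each pile in their original order. The resulting arrangement $\gamma=(\gamma(2),\dots,\gamma(n))$ is the $p$-biased riffle shuffle permutation of $\{2,\dots,n\}$, where $\gamma(j)$ is the card in position $j$. $p$-biased recursive tree ($p$-BRT) of order $n$: the random rooted tree on vertices $1,\dots,n$ with root $1$, obtained by attaching each node $i\ge 2$ to the rightmost element $j$ of $\gamma$ which precedes $i$ and satisfies $j<i$; if there is no such $j$, the parent of $i$ is $1$. A descendant of a vertex $v$ is any vertex that is a child of $v$ or a descendant of a child of $v$ (so $v$ is not its own descendant). Empty sums are $0$.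
   Formalization: The exact variance formula is stated for n ≥ 2k+1; without a range of n it is false, e.g. for a=2, p=(1/3,2/3), n=2, k=1 the variance is 0 but the formula gives 8/81. The limit statement is unchanged. *)

theory Defs
  imports "HOL-Probability.Probability" "HOL-Combinatorics.Multiset_Permutations"
begin

definition prob_vector :: "nat \<Rightarrow> (nat \<Rightarrow> real) \<Rightarrow> bool" where
  "prob_vector a p \<longleftrightarrow> (\<forall>s\<in>{1..a}. 0 \<le> p s) \<and> (\<Sum>s=1..a. p s) = 1"

text \<open>
  A vector indexed by a finite set \<open>A\<close> is encoded as a function on all of \<open>nat\<close> that vanishes
  outside \<open>A\<close>, so that different functions in this set are different vectors.
\<close>

definition weak_compositions :: "nat set \<Rightarrow> nat \<Rightarrow> (nat \<Rightarrow> nat) set" where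
  "weak_compositions A m = {b. (\<forall>s. s \<notin> A \<longrightarrow> b s = 0) \<and> (\<Sum>s\<in>A. b s) = m}"

definition multinomial_pmf :: "nat \<Rightarrow> nat \<Rightarrow> (nat \<Rightarrow> real) \<Rightarrow> (nat \<Rightarrow> nat) pmf" where
  "multinomial_pmf a m p = embed_pmf (\<lambda>b.
     if b \<in> weak_compositions {1..a} m
     then fact m / (\<Prod>s\<in>{1..a}. fact (b s)) * (\<Prod>s\<in>{1..a}. p s ^ b s)
     else 0)"

text \<open>
  The deck \<open>2, \<dots>, n\<close> cut into consecutive piles: pile \<open>s\<close> starts after the cards of the piles
  \<open>1, \<dots>, s - 1\<close>.
\<close>

definition pile :: "(nat \<Rightarrow> nat) \<Rightarrow> nat \<Rightarrow> nat list" where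
  "pile b s = [2 + (\<Sum>u\<in>{1..<s}. b u) ..< 2 + (\<Sum>u\<in>{1..<s}. b u) + b s]"

text \<open>
  An arrangement of the cards is a list, its head being the card in the first position
  (the position with index 2).
\<close>

definition interleavings :: "nat \<Rightarrow> nat \<Rightarrow> (nat \<Rightarrow> nat) \<Rightarrow> nat list set" where
  "interleavings n a b = {\<gamma> \<in> permutations_of_set {2..n}.
     \<forall>s\<in>{1..a}. filter (\<lambda>c. c \<in> set (pile b s)) \<gamma> = pile b s}"

definition riffle_pmf :: "nat \<Rightarrow> nat \<Rightarrow> (nat \<Rightarrow> real) \<Rightarrow> nat list pmf" where
  "riffle_pmf n a p =
     bind_pmf (multinomial_pmf a (n - 1) p) (\<lambda>b. pmf_of_set (interleavings n a b))"

definition brt_parent :: "nat list \<Rightarrow> nat \<Rightarrow> nat" where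
  "brt_parent \<gamma> i =
     (let js = filter (\<lambda>j. j < i) (takeWhile (\<lambda>j. j \<noteq> i) \<gamma>)
      in if js = [] then 1 else last js)"

text \<open>
  A tree of order \<open>n\<close> has the vertex set \<open>{1..n}\<close> and is represented by the set of its pairs
  (parent, child).
\<close>

definition brt_tree :: "nat \<Rightarrow> nat list \<Rightarrow> (nat \<times> nat) set" where
  "brt_tree n \<gamma> = {(brt_parent \<gamma> i, i) | i. i \<in> {2..n}}"

definition brt_pmf :: "nat \<Rightarrow> nat \<Rightarrow> (nat \<Rightarrow> real) \<Rightarrow> (nat \<times> nat) set pmf" where
  "brt_pmf n a p = map_pmf (brt_tree n) (riffle_pmf n a p)"

definition descendants :: "(nat \<times> nat) set \<Rightarrow> nat \<Rightarrow> nat set" where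
  "descendants T v = {w. (v, w) \<in> T\<^sup>+}"

definition num_nodes_ge :: "nat \<Rightarrow> nat \<Rightarrow> (nat \<times> nat) set \<Rightarrow> nat" where
  "num_nodes_ge k n T = card {v \<in> {1..n}. k \<le> card (descendants T v)}"


text \<open>
  The functions \<open>embed_pmf\<close> and \<open>pmf_of_set\<close> are meaningful only for weights that sum to 1 and for
  finite nonempty sets, respectively; the following facts show that both conditions are met.
\<close>

lemma weak_compositions_insert:
  assumes "finite A" "x \<notin> A"
  shows "bij_betw (\<lambda>(i, b). b(x := i)) (SIGMA i:{..m}. weak_compositions A (m - i))
           (weak_compositions (insert x A) m)"
proof (rule bij_betwI[where g = "\<lambda>b. (b x, b(x := 0))"])
  have *: "(\<Sum>s\<in>A. (b(x := i)) s) = (\<Sum>s\<in>A. b s)" for b :: "nat \<Rightarrow> nat" and i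
    using assms(2) by (intro sum.cong) auto
  show "(\<lambda>(i, b). b(x := i)) \<in> (SIGMA i:{..m}. weak_compositions A (m - i))
          \<rightarrow> weak_compositions (insert x A) m"
    using assms by (auto simp: weak_compositions_def *[unfolded fun_upd_def] fun_upd_def)
  show "(\<lambda>b. (b x, b(x := 0))) \<in> weak_compositions (insert x A) m
          \<rightarrow> (SIGMA i:{..m}. weak_compositions A (m - i))"
    using assms by (auto simp: weak_compositions_def *[unfolded fun_upd_def] fun_upd_def)
  show "(\<lambda>b. (b x, b(x := 0))) ((\<lambda>(i, b). b(x := i)) z) = z"
    if "z \<in> (SIGMA i:{..m}. weak_compositions A (m - i))" for z
    using that assms by (auto simp: weak_compositions_def fun_eq_iff)
qed auto

lemma finite_weak_compositions: "finite A \<Longrightarrow> finite (weak_compositions A m)"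
proof (induction A arbitrary: m rule: finite_induct)
  case empty
  have "weak_compositions {} m \<subseteq> {\<lambda>_. 0}" by (auto simp: weak_compositions_def)
  thus ?case by (rule finite_subset) simp
next
  case (insert x A)
  have "finite (SIGMA i:{..m}. weak_compositions A (m - i))"
    using insert.IH by auto
  thus ?case using bij_betw_finite[OF weak_compositions_insert[OF insert.hyps(1,2)]] by simp
qed

lemma sum_weak_compositions:
  fixes p :: "nat \<Rightarrow> real"
  assumes "finite A"
  shows "(\<Sum>b\<in>weak_compositions A m. fact m / (\<Prod>s\<in>A. fact (b s)) * (\<Prod>s\<in>A. p s ^ b s))
           = (\<Sum>s\<in>A. p s) ^ m"
  using assms
proof (induction A arbitrary: m rule: finite_induct)
  case empty
  have "weak_compositions {} m = (if m = 0 then {\<lambda>_. 0} else {})"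
    by (auto simp: weak_compositions_def)
  thus ?case by simp
next
  case (insert x A)
  note fin = finite_weak_compositions[OF insert.hyps(1)]
  let ?w = "\<lambda>B m b. fact m / (\<Prod>s\<in>B. fact (b s)) * (\<Prod>s\<in>B. p s ^ b s) :: real"
  have w: "?w (insert x A) m (b(x := i)) = real (m choose i) * p x ^ i * ?w A (m - i) b"
    if "i \<le> m" for i b
  proof -
    have "(\<Prod>s\<in>A. fact ((b(x := i)) s)) = (\<Prod>s\<in>A. fact (b s) :: real)"
         "(\<Prod>s\<in>A. p s ^ ((b(x := i)) s)) = (\<Prod>s\<in>A. p s ^ b s)"
      using insert.hyps by (auto intro!: prod.cong)
    thus ?thesis using insert.hyps that by (simp add: binomial_fact field_simps)
  qed
  have "(\<Sum>b\<in>weak_compositions (insert x A) m. ?w (insert x A) m b)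
      = (\<Sum>z\<in>(SIGMA i:{..m}. weak_compositions A (m - i)).
            ?w (insert x A) m ((\<lambda>(i, b). b(x := i)) z))"
    by (rule sum.reindex_bij_betw[OF weak_compositions_insert[OF insert.hyps(1,2)], symmetric])
  also have "\<dots> = (\<Sum>(i, b)\<in>(SIGMA i:{..m}. weak_compositions A (m - i)).
                    real (m choose i) * p x ^ i * ?w A (m - i) b)"
  proof (rule sum.cong[OF refl])
    fix z assume "z \<in> (SIGMA i:{..m}. weak_compositions A (m - i))"
    then obtain i b where z: "z = (i, b)" and i: "i \<le> m" by auto
    show "?w (insert x A) m ((\<lambda>(i, b). b(x := i)) z)
        = (case z of (i, b) \<Rightarrow> real (m choose i) * p x ^ i * ?w A (m - i) b)"
      unfolding z prod.case by (rule w[OF i])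
  qed
  also have "\<dots> = (\<Sum>i\<le>m. real (m choose i) * p x ^ i * (\<Sum>s\<in>A. p s) ^ (m - i))"
    using fin by (subst sum.Sigma[symmetric])
      (auto simp: insert.IH[symmetric] sum_distrib_left mult.assoc)
  also have "\<dots> = (p x + (\<Sum>s\<in>A. p s)) ^ m"
    by (simp add: binomial_ring)
  finally show ?case using insert.hyps by simp
qed

lemma pmf_multinomial_pmf:
  assumes "prob_vector a p"
  shows "pmf (multinomial_pmf a m p) b =
     (if b \<in> weak_compositions {1..a} m
      then fact m / (\<Prod>s\<in>{1..a}. fact (b s)) * (\<Prod>s\<in>{1..a}. p s ^ b s) else 0)"
  unfolding multinomial_pmf_def
proof (rule pmf_embed_pmf)
  let ?f = "\<lambda>b. fact m / (\<Prod>s\<in>{1..a}. fact (b s)) * (\<Prod>s\<in>{1..a}. p s ^ b s) :: real"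
  have nonneg: "0 \<le> ?f b" for b
    using assms by (auto simp: prob_vector_def intro!: mult_nonneg_nonneg divide_nonneg_nonneg prod_nonneg)
  thus "0 \<le> (if b \<in> weak_compositions {1..a} m then ?f b else 0)" for b by simp
  have fin: "finite (weak_compositions {1..a} m)" by (rule finite_weak_compositions) simp
  have "(\<integral>\<^sup>+b. ennreal (if b \<in> weak_compositions {1..a} m then ?f b else 0) \<partial>count_space UNIV)
      = (\<Sum>b\<in>weak_compositions {1..a} m. ennreal (?f b))"
    using fin by (subst nn_integral_count_space'[where A = "weak_compositions {1..a} m"]) auto
  also have "\<dots> = ennreal (\<Sum>b\<in>weak_compositions {1..a} m. ?f b)"
    using nonneg by (subst sum_ennreal) auto
  also have "\<dots> = 1"
    using assms by (subst sum_weak_compositions) (auto simp: prob_vector_def)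
  finally show "(\<integral>\<^sup>+b. ennreal (if b \<in> weak_compositions {1..a} m then ?f b else 0)
                   \<partial>count_space UNIV) = 1" .
qed

lemma finite_interleavings: "finite (interleavings n a b)"
  unfolding interleavings_def by simp

lemma interleavings_nonempty:
  assumes "b \<in> weak_compositions {1..a} (n - 1)"
  shows "interleavings n a b \<noteq> {}"
proof -
  have "[2..<Suc n] \<in> interleavings n a b"
    unfolding interleavings_def
  proof (intro CollectI conjI ballI)
    show "[2..<Suc n] \<in> permutations_of_set {2..n}"
      by (auto simp: permutations_of_set_def)
    fix s assume s: "s \<in> {1..a}"
    have "(\<Sum>u\<in>{1..<s}. b u) + b s = (\<Sum>u\<in>{1..s}. b u)"
      using s by (simp add: atLeastLessThanSuc_atLeastAtMost[symmetric])
    also have "\<dots> \<le> (\<Sum>u\<in>{1..a}. b u)"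
      using s by (intro sum_mono2) auto
    also have "\<dots> = n - 1" using assms by (simp add: weak_compositions_def)
    finally have le: "(\<Sum>u\<in>{1..<s}. b u) + b s \<le> n - 1" .
    show "filter (\<lambda>c. c \<in> set (pile b s)) [2..<Suc n] = pile b s"
    proof (rule sorted_distinct_set_unique)
      show "set (filter (\<lambda>c. c \<in> set (pile b s)) [2..<Suc n]) = set (pile b s)"
        using le by (auto simp: pile_def)
      show "sorted (filter (\<lambda>c. c \<in> set (pile b s)) [2..<Suc n])"
        by (intro sorted_wrt_filter sorted_upt)
      show "distinct (filter (\<lambda>c. c \<in> set (pile b s)) [2..<Suc n])"
        by (intro distinct_filter distinct_upt)
      show "sorted (pile b s)" "distinct (pile b s)"
        unfolding pile_def by (rule sorted_upt, rule distinct_upt)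
    qed
  qed
  thus ?thesis by blast
qed

end

theory Submission
  imports Defs
begin

text \<open>
  Replace every card of the shuffled deck by the number of its pile. Since the cards of a pile keep
  their order and lower piles hold lower cards, the card in position \<open>i\<close> is smaller than the card
  in a later position \<open>j\<close> iff its pile number is at most that of the card in position \<open>j\<close>. For
  fixed pile sizes \<open>b\<close> the word of pile numbers determines the interleaving, and every word with
  \<open>b s\<close> letters \<open>s\<close> occurs (\<open>bij_betw_interleavings_words\<close>); the multinomial choice of \<open>b\<close>
  therefore makes the word a sequence of \<open>n - 1\<close> independent letters with distribution \<open>p\<close>
  (\<open>riffle_words_iid\<close>).

  List the vertices of the tree as \<open>1 # \<gamma>\<close>. The descendants of the vertex in position \<open>v\<close> are the
  vertices in the longest run of positions directly after \<open>v\<close> that carry only larger cards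
  (\<open>brt_tree_trancl_iff\<close>). So a vertex has at least \<open>k\<close> descendants iff the next \<open>k\<close> positions
  exist and carry larger cards. The root contributes 1 to the count, and the position \<open>i\<close> of the
  word contributes iff its letter is minimal among itself and the following \<open>k\<close> letters
  (\<open>brt_node_count_iid\<close>).

  It remains to find the variance of a sum of \<open>N = n - k - 1\<close> indicators over an i.i.d. word. Write
  \<open>q s\<close> for the probability of a letter \<open>\<ge> s\<close> and \<open>T s = (\<Sum>r\<ge>s. p r * q r ^ k)\<close>. Each
  indicator has mean \<open>T 1\<close>. Indicators at distance \<open>d > k\<close> depend on disjoint blocks of letters
  and are independent. At distance \<open>1 \<le> d \<le> k\<close>, conditioning on the first letter \<open>s\<close> and on the
  letter \<open>r \<ge> s\<close> at the second position gives the joint probability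
  \<open>\<Sum>s. p s * q s ^ (d - 1) * T s\<close>, because the letters after the second position are \<open>\<ge> r \<ge> s\<close>
  anyway. There are \<open>N - d\<close> pairs at distance \<open>d\<close> (\<open>variance_card_low_starts\<close>), and summing over
  \<open>d\<close> (\<open>sum_arith_geometric\<close>, with the term \<open>s = 1\<close>, where \<open>q 1 = 1\<close>, treated apart) yields the
  formula. It is affine in \<open>n\<close>, so the limit is its slope.
\<close>

section \<open>Words of pile numbers\<close>

text \<open>
  The number of the pile that contains card \<open>c\<close> when the deck is cut into piles of sizes \<open>b\<close>: pile
  \<open>s\<close> ends just before card \<open>2 + (\<Sum>u\<in>{1..s}. b u)\<close>. Only cards of the deck have a meaningful value.
\<close>

definition pile_index :: "(nat \<Rightarrow> nat) \<Rightarrow> nat \<Rightarrow> nat" where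
  "pile_index b c = (LEAST s. c < 2 + (\<Sum>u\<in>{1..s}. b u))"

text \<open>The words with exactly \<open>b s\<close> letters \<open>s\<close>, for every \<open>s\<close>.\<close>

definition words :: "(nat \<Rightarrow> nat) \<Rightarrow> nat list set" where
  "words b = {w. \<forall>s. count (mset w) s = b s}"

text \<open>
  The interleaving of the lists \<open>P s\<close> prescribed by a word: each letter \<open>s\<close> of the word takes the
  next element of \<open>P s\<close>. It inverts the map from interleavings to words.
\<close>

fun deal :: "nat list \<Rightarrow> (nat \<Rightarrow> 'c list) \<Rightarrow> 'c list" where
  "deal [] P = []"
| "deal (s # w) P = hd (P s) # deal w (P(s := tl (P s)))"

lemma deal_correct:
  assumes "\<And>s x. x \<in> set (P s) \<Longrightarrow> c x = s"
    and "\<And>s. count (mset w) s = length (P s)"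
  shows "map c (deal w P) = w \<and> (\<forall>s. filter (\<lambda>x. c x = s) (deal w P) = P s)"
  using assms
proof (induction w arbitrary: P)
  case Nil
  thus ?case by simp
next
  case (Cons r w)
  have "P r \<noteq> []"
  proof
    assume "P r = []"
    thus False using Cons.prems(2)[of r] by simp
  qed
  then obtain y ys where P: "P r = y # ys" by (cases "P r") auto
  have y: "c y = r" using Cons.prems(1)[of y r] P by simp
  define Q where "Q = P(r := ys)"
  have 1: "c x = s" if "x \<in> set (Q s)" for s x
    using that Cons.prems(1)[of x s] P by (auto simp: Q_def split: if_splits)
  have 2: "count (mset w) s = length (Q s)" for s
    using Cons.prems(2)[of s] P by (auto simp: Q_def split: if_splits)
  from Cons.IH[OF 1 2] have "map c (deal w Q) = w" "\<And>s. filter (\<lambda>x. c x = s) (deal w Q) = Q s"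
    by auto
  thus ?case using P y by (auto simp: Q_def)
qed

lemma deal_unique:
  assumes "\<And>s. filter (\<lambda>x. c x = s) xs = P s"
  shows "deal (map c xs) P = xs"
  using assms
proof (induction xs arbitrary: P)
  case Nil
  thus ?case by simp
next
  case (Cons x xs)
  have P: "P (c x) = x # filter (\<lambda>y. c y = c x) xs" using Cons.prems[of "c x"] by simp
  have "filter (\<lambda>y. c y = s) xs = (P(c x := tl (P (c x)))) s" for s
    using Cons.prems[of s] P by (auto split: if_splits)
  hence "deal (map c xs) (P(c x := tl (P (c x)))) = xs" by (rule Cons.IH)
  thus ?case by (simp add: P)
qed

lemma weak_compositions_partial_sum_le:
  assumes "b \<in> weak_compositions {1..a} m"
  shows "(\<Sum>u\<in>{1..s}. b u) \<le> m"
proof -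
  have "(\<Sum>u\<in>{1..s}. b u) = (\<Sum>u\<in>{1..s} \<inter> {1..a}. b u)"
    using assms by (intro sum.mono_neutral_right) (auto simp: weak_compositions_def)
  also have "\<dots> \<le> (\<Sum>u\<in>{1..a}. b u)" by (intro sum_mono2) auto
  finally show ?thesis using assms by (simp add: weak_compositions_def)
qed

lemma set_pile_iff:
  assumes "b 0 = 0"
  shows "c \<in> set (pile b s) \<longleftrightarrow> 2 \<le> c \<and> c < 2 + (\<Sum>u\<in>{1..s}. b u) \<and> pile_index b c = s"
proof -
  have split: "(\<Sum>u\<in>{1..s}. b u) = (\<Sum>u\<in>{1..<s}. b u) + b s"
  proof (cases s)
    case 0
    thus ?thesis using assms by simp
  next
    case (Suc s')
    thus ?thesis by (simp add: atLeastLessThanSuc_atLeastAtMost)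
  qed
  have mono: "(\<Sum>u\<in>{1..r}. b u) \<le> (\<Sum>u\<in>{1..<s}. b u)" if "r < s" for r
    using that by (intro sum_mono2) auto
  have range: "c \<in> set (pile b s) \<longleftrightarrow>
      2 + (\<Sum>u\<in>{1..<s}. b u) \<le> c \<and> c < 2 + (\<Sum>u\<in>{1..s}. b u)"
    by (simp only: pile_def set_upt atLeastLessThan_iff split add.assoc)
  show ?thesis
  proof
    assume c: "c \<in> set (pile b s)"
    have "pile_index b c = s"
      unfolding pile_index_def
    proof (rule Least_equality)
      show "c < 2 + (\<Sum>u\<in>{1..s}. b u)" using c range by blast
      fix r assume "c < 2 + (\<Sum>u\<in>{1..r}. b u)"
      thus "s \<le> r" using mono[of r] c unfolding range by linarith
    qed
    thus "2 \<le> c \<and> c < 2 + (\<Sum>u\<in>{1..s}. b u) \<and> pile_index b c = s"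
      using c unfolding range by linarith
  next
    assume c: "2 \<le> c \<and> c < 2 + (\<Sum>u\<in>{1..s}. b u) \<and> pile_index b c = s"
    have "2 + (\<Sum>u\<in>{1..<s}. b u) \<le> c"
    proof (cases s)
      case 0
      thus ?thesis using c by simp
    next
      case (Suc s')
      have "\<not> c < 2 + (\<Sum>u\<in>{1..s'}. b u)"
        using c Suc not_less_Least[of s' "\<lambda>s. c < 2 + (\<Sum>u\<in>{1..s}. b u)"]
        by (simp add: pile_index_def)
      thus ?thesis using Suc by (simp add: atLeastLessThanSuc_atLeastAtMost)
    qed
    thus "c \<in> set (pile b s)" using c range by blast
  qed
qed

lemma pile_index_less:
  assumes "c < 2 + (\<Sum>u\<in>{1..s}. b u)" "pile_index b c < pile_index b d"
  shows "c < d"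
proof -
  have "c < 2 + (\<Sum>u\<in>{1..pile_index b c}. b u)"
    unfolding pile_index_def by (rule LeastI) (rule assms(1))
  moreover have "\<not> d < 2 + (\<Sum>u\<in>{1..pile_index b c}. b u)"
    using assms(2) unfolding pile_index_def by (rule not_less_Least)
  ultimately show ?thesis by simp
qed

lemma mem_own_pile_iff:
  assumes "b \<in> weak_compositions {1..a} m"
  shows "c \<in> set (pile b (pile_index b c)) \<longleftrightarrow> 2 \<le> c \<and> c < 2 + m"
proof -
  have b0: "b 0 = 0" and tot: "(\<Sum>u\<in>{1..a}. b u) = m"
    using assms by (auto simp: weak_compositions_def)
  have "c < 2 + (\<Sum>u\<in>{1..pile_index b c}. b u) \<longleftrightarrow> c < 2 + m"
  proof
    assume "c < 2 + m"
    hence "c < 2 + (\<Sum>u\<in>{1..a}. b u)" by (simp only: tot)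
    thus "c < 2 + (\<Sum>u\<in>{1..pile_index b c}. b u)"
      unfolding pile_index_def by (rule LeastI)
  qed (use weak_compositions_partial_sum_le[OF assms, of "pile_index b c"] in linarith)
  thus ?thesis using set_pile_iff[of b c "pile_index b c", OF b0] by simp
qed

text \<open>
  The filter condition at each pile already forces \<open>\<gamma>\<close> to be a permutation of the deck: the piles
  partition the deck, and each card occurs in \<open>\<gamma>\<close> as often as in its own pile.
\<close>

lemma interleavings_iff:
  assumes b: "b \<in> weak_compositions {1..a} (n - 1)"
  shows "\<gamma> \<in> interleavings n a b \<longleftrightarrow> (\<forall>s. filter (\<lambda>c. pile_index b c = s) \<gamma> = pile b s)"
proof -
  have b0: "b 0 = 0" using b by (auto simp: weak_compositions_def)
  have own: "c \<in> set (pile b (pile_index b c)) \<longleftrightarrow> c \<in> {2..n}" for c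
    using mem_own_pile_iff[OF b, of c] by auto
  have mem: "c \<in> set (pile b s) \<longleftrightarrow> pile_index b c = s" if "c \<in> {2..n}" for c s
    using that own[of c] set_pile_iff[of b, OF b0] by metis
  have outside: "pile b s = []" if "s \<notin> {1..a}" for s
    using that b by (simp add: pile_def weak_compositions_def)
  show ?thesis
  proof
    assume g: "\<gamma> \<in> interleavings n a b"
    hence sg: "set \<gamma> = {2..n}" by (auto simp: interleavings_def permutations_of_set_def)
    have eq: "filter (\<lambda>c. pile_index b c = s) \<gamma> = filter (\<lambda>c. c \<in> set (pile b s)) \<gamma>" for s
      using mem sg by (intro filter_cong) auto
    show "\<forall>s. filter (\<lambda>c. pile_index b c = s) \<gamma> = pile b s"
    proof
      fix s
      show "filter (\<lambda>c. pile_index b c = s) \<gamma> = pile b s"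
      proof (cases "s \<in> {1..a}")
        case True
        thus ?thesis using g unfolding eq by (auto simp: interleavings_def)
      next
        case False
        thus ?thesis unfolding eq by (simp add: outside)
      qed
    qed
  next
    assume *: "\<forall>s. filter (\<lambda>c. pile_index b c = s) \<gamma> = pile b s"
    have "x \<in> set \<gamma> \<longleftrightarrow> x \<in> set (pile b (pile_index b x))" for x
      using arg_cong[OF spec[OF *, of "pile_index b x"], of set] by auto
    hence sg: "set \<gamma> = {2..n}" using own by blast
    have "count (mset \<gamma>) x \<le> 1" for x
    proof -
      have "count (mset \<gamma>) x = count (mset (filter (\<lambda>c. pile_index b c = pile_index b x) \<gamma>)) x"
        by (simp add: mset_filter)
      also have "\<dots> = count (mset (pile b (pile_index b x))) x" using * by simp
      also have "\<dots> \<le> 1" by (simp add: pile_def distinct_count_atmost_1[THEN iffD1])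
      finally show ?thesis .
    qed
    hence "distinct \<gamma>"
      unfolding distinct_count_atmost_1
      by (metis count_mset_0_iff le_antisym less_one linorder_not_le)
    moreover have "filter (\<lambda>c. c \<in> set (pile b s)) \<gamma> = pile b s" for s
    proof -
      have "filter (\<lambda>c. c \<in> set (pile b s)) \<gamma> = filter (\<lambda>c. pile_index b c = s) \<gamma>"
        using mem sg by (intro filter_cong) auto
      thus ?thesis using * by simp
    qed
    ultimately show "\<gamma> \<in> interleavings n a b"
      using sg by (auto simp: interleavings_def permutations_of_set_def)
  qed
qed

lemma bij_betw_interleavings_words:
  assumes b: "b \<in> weak_compositions {1..a} (n - 1)"
  shows "bij_betw (map (pile_index b)) (interleavings n a b) (words b)"
proof (rule bij_betwI[where g = "\<lambda>w. deal w (pile b)"])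
  have b0: "b 0 = 0" using b by (auto simp: weak_compositions_def)
  have P: "pile_index b x = s" if "x \<in> set (pile b s)" for s x
    using that set_pile_iff[of b, OF b0] by blast
  have len: "length (pile b s) = b s" for s
    by (simp only: pile_def length_upt diff_add_inverse)
  have deal: "map (pile_index b) (deal w (pile b)) = w \<and>
      (\<forall>s. filter (\<lambda>x. pile_index b x = s) (deal w (pile b)) = pile b s)" if "w \<in> words b" for w
    using that by (intro deal_correct) (auto simp: P words_def len)
  show "map (pile_index b) \<in> interleavings n a b \<rightarrow> words b"
  proof
    fix \<gamma> assume g: "\<gamma> \<in> interleavings n a b"
    have "count (mset (map (pile_index b) \<gamma>)) s = b s" for s
    proof -
      have "count (mset (map (pile_index b) \<gamma>)) s = length (filter (\<lambda>c. pile_index b c = s) \<gamma>)"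
        by (induction \<gamma>) auto
      thus ?thesis using g interleavings_iff[OF b] len by simp
    qed
    thus "map (pile_index b) \<gamma> \<in> words b" by (simp add: words_def)
  qed
  show "(\<lambda>w. deal w (pile b)) \<in> words b \<rightarrow> interleavings n a b"
    using deal interleavings_iff[OF b] by auto
  show "deal (map (pile_index b) \<gamma>) (pile b) = \<gamma>" if "\<gamma> \<in> interleavings n a b" for \<gamma>
    using that interleavings_iff[OF b] by (intro deal_unique) auto
  show "map (pile_index b) (deal w (pile b)) = w" if "w \<in> words b" for w
    using deal[OF that] by simp
qed

lemma card_words:
  assumes b: "b \<in> weak_compositions {1..a} m"
  shows "card (words b) * (\<Prod>s\<in>{1..a}. fact (b s)) = fact m"
proof -
  define M where "M = Abs_multiset b"
  have supp: "{s. 0 < b s} \<subseteq> {1..a}" using b by (force simp: weak_compositions_def)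
  hence "finite {s. 0 < b s}" by (rule finite_subset) simp
  hence M: "count M = b" by (simp add: M_def)
  have setM: "set_mset M \<subseteq> {1..a}" using supp M by (auto simp: set_mset_def)
  have "words b = permutations_of_multiset M"
    by (auto simp: words_def permutations_of_multiset_def multiset_eq_iff M)
  moreover have "(\<Prod>s\<in>{1..a}. fact (b s)) = (\<Prod>s\<in>set_mset M. fact (count M s) :: nat)"
    using setM unfolding M[symmetric]
    by (intro prod.mono_neutral_right) (auto simp: not_in_iff)
  moreover have "size M = m"
  proof -
    have "size M = (\<Sum>s\<in>set_mset M. b s)" by (simp add: size_multiset_overloaded_eq M)
    also have "\<dots> = (\<Sum>s\<in>{1..a}. b s)"
      using setM unfolding M[symmetric]
      by (intro sum.mono_neutral_left) (auto simp: not_in_iff)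
    finally show ?thesis using b by (simp add: weak_compositions_def)
  qed
  ultimately show ?thesis using card_permutations_of_multiset_aux[of M] by simp
qed

section \<open>The word of a riffle shuffle is i.i.d.\<close>

text \<open>The distribution of a single letter: \<open>s \<in> {1..a}\<close> has probability \<open>p s\<close>.\<close>

definition letter_pmf :: "nat \<Rightarrow> (nat \<Rightarrow> real) \<Rightarrow> nat pmf" where
  "letter_pmf a p = embed_pmf (\<lambda>s. if s \<in> {1..a} then p s else 0)"

lemma pmf_letter_pmf:
  assumes "prob_vector a p"
  shows "pmf (letter_pmf a p) s = (if s \<in> {1..a} then p s else 0)"
  unfolding letter_pmf_def
proof (rule pmf_embed_pmf)
  show "0 \<le> (if s \<in> {1..a} then p s else 0)" for s
    using assms by (auto simp: prob_vector_def)
  have "(\<integral>\<^sup>+s. ennreal (if s \<in> {1..a} then p s else 0) \<partial>count_space UNIV)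
      = (\<Sum>s\<in>{1..a}. ennreal (p s))"
    by (subst nn_integral_count_space'[where A = "{1..a}"]) auto
  also have "\<dots> = ennreal (\<Sum>s\<in>{1..a}. p s)"
    using assms by (subst sum_ennreal) (auto simp: prob_vector_def)
  finally show "(\<integral>\<^sup>+s. ennreal (if s \<in> {1..a} then p s else 0) \<partial>count_space UNIV) = 1"
    using assms by (simp add: prob_vector_def)
qed

text \<open>
  Infinite words \<open>f\<close> whose first \<open>m\<close> letters are independent with distribution \<open>D\<close>; the letters
  \<open>f j\<close> for \<open>j \<ge> m\<close> have the dummy value 0 and play no role.
\<close>

abbreviation iid_pmf :: "nat \<Rightarrow> nat pmf \<Rightarrow> (nat \<Rightarrow> nat) pmf" where
  "iid_pmf m D \<equiv> Pi_pmf {..<m} 0 (\<lambda>_. D)"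

lemma pmf_word:
  "pmf (map_pmf (\<lambda>f. map f [0..<m]) (iid_pmf m D)) w
     = (if length w = m then \<Prod>s\<in>#mset w. pmf D s else 0)"
proof (cases "length w = m")
  case True
  let ?f = "\<lambda>f :: nat \<Rightarrow> nat. map f [0..<m]"
  define g where "g = (\<lambda>i. if i < m then w ! i else 0)"
  have w: "?f g = w" using True by (intro nth_equalityI) (auto simp: g_def)
  have "pmf (map_pmf ?f (iid_pmf m D)) w = measure (iid_pmf m D) (?f -` {w})"
    by (simp add: pmf_map)
  also have "\<dots> = measure (iid_pmf m D) {g}"
  proof (rule measure_prob_cong_0)
    fix h assume h: "h \<in> ?f -` {w} - {g}"
    have "\<exists>i. i \<notin> {..<m} \<and> h i \<noteq> 0"
    proof (rule ccontr)
      assume "\<not> ?thesis"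
      hence "h = g" using h by (auto simp: g_def fun_eq_iff)
      thus False using h by simp
    qed
    thus "pmf (iid_pmf m D) h = 0" by (auto intro!: pmf_Pi_outside)
  qed (use w in auto)
  also have "\<dots> = (\<Prod>i<m. pmf D (g i))"
    by (simp add: measure_pmf_single pmf_Pi g_def)
  also have "\<dots> = (\<Prod>i<length w. pmf D (w ! i))"
    using True by (auto simp: g_def)
  also have "\<dots> = prod_list (map (pmf D) w)"
    by (simp add: prod.list_conv_set_nth atLeast0LessThan)
  also have "\<dots> = (\<Prod>s\<in>#mset w. pmf D s)" by (simp add: prod_mset_prod_list flip: mset_map)
  finally show ?thesis using True by simp
next
  case False
  hence "w \<notin> set_pmf (map_pmf (\<lambda>f. map f [0..<m]) (iid_pmf m D))" by auto
  thus ?thesis using False by (simp only: pmf_eq_0_set_pmf if_False not_False_eq_True)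
qed

text \<open>
  A word with content \<open>b\<close> has probability \<open>multinomial(b) / card (words b)\<close> on the left. As the
  multinomial coefficient equals \<open>card (words b)\<close>, what remains is \<open>\<Prod>s. p s ^ b s\<close>.
\<close>

lemma riffle_words_iid:
  assumes p: "prob_vector a p"
  shows "bind_pmf (multinomial_pmf a (n - 1) p)
           (\<lambda>b. map_pmf (map (pile_index b)) (pmf_of_set (interleavings n a b)))
         = map_pmf (\<lambda>f. map f [0..<n - 1]) (iid_pmf (n - 1) (letter_pmf a p))"
    (is "?L = ?R")
proof (rule pmf_eqI)
  fix w :: "nat list"
  let ?W = "weak_compositions {1..a} (n - 1)"
  let ?c = "count (mset w)"
  have fin: "finite ?W" by (rule finite_weak_compositions) simp
  have wd: "map_pmf (map (pile_index b)) (pmf_of_set (interleavings n a b)) = pmf_of_set (words b)"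
    if "b \<in> ?W" for b
    using that bij_betw_interleavings_words interleavings_nonempty finite_interleavings
    by (intro map_pmf_of_set_bij_betw) auto
  have words: "finite (words b)" "words b \<noteq> {}" if "b \<in> ?W" for b
    using bij_betw_interleavings_words[OF that] interleavings_nonempty[OF that]
      finite_interleavings[of n a b]
    by (auto simp: bij_betw_def simp flip: bij_betw_finite)
  have "pmf ?L w = (\<integral>b. pmf (map_pmf (map (pile_index b)) (pmf_of_set (interleavings n a b))) w
          \<partial>multinomial_pmf a (n - 1) p)"
    by (simp add: pmf_bind)
  also have "\<dots> = (\<Sum>b\<in>?W. pmf (map_pmf (map (pile_index b)) (pmf_of_set (interleavings n a b))) w
          * pmf (multinomial_pmf a (n - 1) p) b)"
    using fin by (intro integral_measure_pmf_real)
      (auto simp: set_pmf_iff pmf_multinomial_pmf[OF p] split: if_splits)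
  also have "\<dots> = (\<Sum>b\<in>?W. if b = ?c then \<Prod>s\<in>{1..a}. p s ^ b s else 0)"
  proof (rule sum.cong[OF refl])
    fix b assume b: "b \<in> ?W"
    have iff: "w \<in> words b \<longleftrightarrow> b = ?c" by (auto simp: words_def)
    have cw: "real (card (words b)) * (\<Prod>s\<in>{1..a}. fact (b s)) = fact (n - 1)"
      using arg_cong[OF card_words[OF b], of real] by simp
    have nz: "real (card (words b)) \<noteq> 0" "(\<Prod>s\<in>{1..a}. fact (b s) :: real) \<noteq> 0"
      using words[OF b] by auto
    show "pmf (map_pmf (map (pile_index b)) (pmf_of_set (interleavings n a b))) w
          * pmf (multinomial_pmf a (n - 1) p) b = (if b = ?c then \<Prod>s\<in>{1..a}. p s ^ b s else 0)"
    proof (cases "b = ?c")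
      case True
      hence "pmf (pmf_of_set (words b)) w = 1 / real (card (words b))"
        using words[OF b] iff by simp
      moreover have "pmf (multinomial_pmf a (n - 1) p) b
          = real (card (words b)) * (\<Prod>s\<in>{1..a}. p s ^ b s)"
        using nz by (simp only: pmf_multinomial_pmf[OF p] b if_True flip: cw) simp
      ultimately show ?thesis using True nz unfolding wd[OF b] by simp
    next
      case False
      hence "pmf (pmf_of_set (words b)) w = 0" using words[OF b] iff by simp
      thus ?thesis using False by (simp only: wd[OF b] if_False mult_zero_left)
    qed
  qed
  also have "\<dots> = (if ?c \<in> ?W then \<Prod>s\<in>{1..a}. p s ^ ?c s else 0)"
    using fin by (simp add: sum.delta)
  also have "\<dots> = pmf ?R w"
  proof (cases "set w \<subseteq> {1..a}")
    case True
    have len: "(\<Sum>s\<in>{1..a}. ?c s) = length w"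
    proof -
      have "length w = (\<Sum>s\<in>set w. ?c s)"
        using size_multiset_overloaded_eq[of "mset w"] by simp
      also have "\<dots> = (\<Sum>s\<in>{1..a}. ?c s)"
        using True by (intro sum.mono_neutral_left) (auto simp: count_mset_0_iff)
      finally show ?thesis by simp
    qed
    have W: "?c \<in> ?W \<longleftrightarrow> length w = n - 1"
      using True len by (auto simp: weak_compositions_def count_mset_0_iff)
    have "(\<Prod>s\<in>#mset w. pmf (letter_pmf a p) s) = (\<Prod>s\<in>set w. pmf (letter_pmf a p) s ^ ?c s)"
      using image_prod_mset_multiplicity[of "pmf (letter_pmf a p)" "mset w"] by simp
    also have "\<dots> = (\<Prod>s\<in>{1..a}. pmf (letter_pmf a p) s ^ ?c s)"
      using True by (intro prod.mono_neutral_left) (auto simp: count_mset_0_iff[THEN iffD2])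
    also have "\<dots> = (\<Prod>s\<in>{1..a}. p s ^ ?c s)"
      by (intro prod.cong) (auto simp: pmf_letter_pmf[OF p])
    finally show ?thesis using W by (simp add: pmf_word)
  next
    case False
    then obtain s where s: "s \<in> set w" "s \<notin> {1..a}" by blast
    hence "?c s \<noteq> 0" by (simp add: count_mset_0_iff)
    hence "?c \<notin> ?W" using s(2) by (auto simp: weak_compositions_def)
    moreover have "(\<Prod>s\<in>#mset w. pmf (letter_pmf a p) s) = 0"
      using s by (auto simp: prod_mset_zero_iff pmf_letter_pmf[OF p] intro!: image_eqI[of _ _ s])
    ultimately show ?thesis by (simp only: pmf_word if_False split: if_splits) simp
  qed
  finally show "pmf ?L w = pmf ?R w" .
qed

section \<open>Descendants in the tree of an arrangement\<close>

lemma takeWhile_neq_nth: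
  assumes "distinct xs" "i < length xs"
  shows "takeWhile (\<lambda>x. x \<noteq> xs ! i) xs = take i xs"
  using assms by (intro takeWhile_eq_take_P_nth) (auto simp: nth_eq_iff_index_eq)

lemma filter_take_last:
  assumes "length xs \<ge> x" "y < x" "P (xs ! y)" "\<And>z. y < z \<Longrightarrow> z < x \<Longrightarrow> \<not> P (xs ! z)"
  shows "filter P (take x xs) \<noteq> [] \<and> last (filter P (take x xs)) = xs ! y"
proof -
  have "take x xs = take y xs @ xs ! y # drop (Suc y) (take x xs)"
    using id_take_nth_drop[of y "take x xs"] assms(1,2) by (simp add: min_def)
  moreover have "filter P (drop (Suc y) (take x xs)) = []"
    using assms by (auto simp: filter_empty_conv in_set_conv_nth)
  ultimately have "filter P (take x xs) = filter P (take y xs) @ [xs ! y]"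
    using assms(3) by (metis filter.simps(2) filter_append)
  thus ?thesis by simp
qed

text \<open>
  With the root placed in front of the arrangement, the default parent \<open>1\<close> is no longer a special
  case: the parent of a card is always the nearest smaller entry before it.
\<close>

lemma brt_tree_edge_iff:
  assumes g: "distinct \<gamma>" "set \<gamma> = {2..n}"
    and x: "0 < x" "x \<le> length \<gamma>"
  shows "(u, (1 # \<gamma>) ! x) \<in> brt_tree n \<gamma> \<longleftrightarrow>
    (\<exists>y<x. u = (1 # \<gamma>) ! y \<and> (1 # \<gamma>) ! y < (1 # \<gamma>) ! x \<and>
       (\<forall>z. y < z \<longrightarrow> z < x \<longrightarrow> (1 # \<gamma>) ! x < (1 # \<gamma>) ! z))"
proof -
  let ?g = "1 # \<gamma>"
  define i where "i = ?g ! x"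
  define A where "A = {y. y < x \<and> ?g ! y < i}"
  have dist: "distinct ?g" using g by auto
  obtain x' where x': "x = Suc x'" "x' < length \<gamma>" using x by (cases x) auto
  hence i: "i = \<gamma> ! x'" "i \<in> {2..n}" using g nth_mem by (auto simp: i_def)
  hence "0 \<in> A" using x by (auto simp: A_def)
  moreover have finA: "finite A" by (auto simp: A_def)
  ultimately have "Max A \<in> A" by (intro Max_in) auto
  \<comment> \<open>the position of the parent: the last smaller entry before position \<open>x\<close>\<close>
  define y where "y = Max A"
  have y: "y < x" "?g ! y < i" using \<open>Max A \<in> A\<close> by (auto simp: A_def y_def)
  have after: "i < ?g ! z" if "y < z" "z < x" for z
  proof -
    have "z \<notin> A" using that(1) finA Max_ge unfolding y_def by (metis not_le)
    moreover have "?g ! z \<noteq> ?g ! x" using dist that x by (subst nth_eq_iff_index_eq) auto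
    ultimately show ?thesis using that by (auto simp: A_def i_def)
  qed
  have tw: "takeWhile (\<lambda>j. j \<noteq> i) \<gamma> = take x' \<gamma>"
    unfolding i by (rule takeWhile_neq_nth[OF g(1) x'(2)])
  have parent: "brt_parent \<gamma> i = ?g ! y"
  proof (cases y)
    case 0
    have "filter (\<lambda>j. j < i) (take x' \<gamma>) = []"
    proof (subst filter_empty_conv, intro ballI)
      fix c assume "c \<in> set (take x' \<gamma>)"
      then obtain z where z: "z < x'" "c = \<gamma> ! z" using x' by (auto simp: in_set_conv_nth)
      show "\<not> c < i" using after[of "Suc z"] z x' 0 by simp
    qed
    thus ?thesis using 0 by (simp add: brt_parent_def tw)
  next
    case (Suc y')
    have "filter (\<lambda>j. j < i) (take x' \<gamma>) \<noteq> [] \<and> last (filter (\<lambda>j. j < i) (take x' \<gamma>)) = \<gamma> ! y'"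
    proof (rule filter_take_last)
      show "\<not> \<gamma> ! z < i" if "y' < z" "z < x'" for z
        using after[of "Suc z"] that Suc x' by simp
    qed (use y Suc x' in auto)
    thus ?thesis using Suc by (simp add: brt_parent_def tw Let_def)
  qed
  have "(u, i) \<in> brt_tree n \<gamma> \<longleftrightarrow> u = ?g ! y" using i(2) parent by (auto simp: brt_tree_def)
  also have "\<dots> \<longleftrightarrow> (\<exists>y<x. u = ?g ! y \<and> ?g ! y < i \<and> (\<forall>z. y < z \<longrightarrow> z < x \<longrightarrow> i < ?g ! z))"
  proof
    assume "u = ?g ! y"
    thus "\<exists>y<x. u = ?g ! y \<and> ?g ! y < i \<and> (\<forall>z. y < z \<longrightarrow> z < x \<longrightarrow> i < ?g ! z)"
      using y after by blast
  next
    assume "\<exists>y<x. u = ?g ! y \<and> ?g ! y < i \<and> (\<forall>z. y < z \<longrightarrow> z < x \<longrightarrow> i < ?g ! z)"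
    then obtain y2 where y2: "y2 < x" "u = ?g ! y2" "?g ! y2 < i"
      "\<And>z. y2 < z \<Longrightarrow> z < x \<Longrightarrow> i < ?g ! z" by blast
    have "y2 = y" using y2(4)[of y] after[of y2] y y2(1,3) by (metis less_asym' linorder_neqE_nat)
    thus "u = ?g ! y" using y2(2) by simp
  qed
  finally show ?thesis by (simp only: i_def)
qed

lemma brt_tree_trancl_iff:
  assumes g: "distinct \<gamma>" "set \<gamma> = {2..n}" and v: "v \<le> length \<gamma>"
  shows "((1 # \<gamma>) ! v, u) \<in> (brt_tree n \<gamma>)\<^sup>+ \<longleftrightarrow>
    (\<exists>x. v < x \<and> x \<le> length \<gamma> \<and> u = (1 # \<gamma>) ! x \<and>
       (\<forall>y. v < y \<longrightarrow> y \<le> x \<longrightarrow> (1 # \<gamma>) ! v < (1 # \<gamma>) ! y))"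
proof
  let ?g = "1 # \<gamma>"
  let ?T = "brt_tree n \<gamma>"
  have dist: "distinct ?g" using g by auto
  note edge = brt_tree_edge_iff[OF g]
  have child: "\<exists>x. 0 < x \<and> x \<le> length \<gamma> \<and> c = ?g ! x" if "(u, c) \<in> ?T" for u c
  proof -
    have "c \<in> set \<gamma>" using that g by (auto simp: brt_tree_def)
    then obtain x where "x < length \<gamma>" "c = \<gamma> ! x" by (auto simp: in_set_conv_nth)
    thus ?thesis by (intro exI[of _ "Suc x"]) auto
  qed
  have inj: "x = y" if "?g ! x = ?g ! y" "x \<le> length \<gamma>" "y \<le> length \<gamma>" for x y
    using that dist by (subst (asm) nth_eq_iff_index_eq) auto
  {
    assume "(?g ! v, u) \<in> ?T\<^sup>+"
    thus "\<exists>x. v < x \<and> x \<le> length \<gamma> \<and> u = ?g ! x \<and> (\<forall>y. v < y \<longrightarrow> y \<le> x \<longrightarrow> ?g ! v < ?g ! y)"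
    proof (induction rule: trancl_induct)
      case (base c)
      then obtain x where x: "0 < x" "x \<le> length \<gamma>" "c = ?g ! x" using child by blast
      with base obtain y where y: "y < x" "?g ! v = ?g ! y" "?g ! y < ?g ! x"
        "\<And>z. y < z \<Longrightarrow> z < x \<Longrightarrow> ?g ! x < ?g ! z" using edge[OF x(1,2)] by blast
      have "v = y" by (rule inj) (use y(1,2) x(2) v in auto)
      hence "?g ! v < ?g ! z" if "v < z" "z \<le> x" for z
        using that y by (cases "z = x") (auto intro: less_trans)
      thus ?case using \<open>v = y\<close> y(1) x by blast
    next
      case (step c d)
      then obtain x where x: "v < x" "x \<le> length \<gamma>" "c = ?g ! x"
        "\<And>y. v < y \<Longrightarrow> y \<le> x \<Longrightarrow> ?g ! v < ?g ! y" by blast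
      obtain x2 where x2: "0 < x2" "x2 \<le> length \<gamma>" "d = ?g ! x2" using child step.hyps by blast
      with step.hyps obtain y where y: "y < x2" "c = ?g ! y" "?g ! y < ?g ! x2"
        "\<And>z. y < z \<Longrightarrow> z < x2 \<Longrightarrow> ?g ! x2 < ?g ! z" using edge[OF x2(1,2)] by blast
      have "x = y" by (rule inj) (use x(2,3) y(1,2) x2(2) in auto)
      have "?g ! v < ?g ! z" if "v < z" "z \<le> x2" for z
      proof (cases "z \<le> x")
        case True
        thus ?thesis using x(4) that by blast
      next
        case False
        have "?g ! v < ?g ! x2" using x(4)[of x] x(1) y(3) \<open>x = y\<close> by simp
        thus ?thesis using y(4)[of z] False that \<open>x = y\<close> by (cases "z = x2") auto
      qed
      thus ?case using x(1) y(1) \<open>x = y\<close> x2 less_trans by blast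
    qed
  }
  {
    assume "\<exists>x. v < x \<and> x \<le> length \<gamma> \<and> u = ?g ! x \<and> (\<forall>y. v < y \<longrightarrow> y \<le> x \<longrightarrow> ?g ! v < ?g ! y)"
    then obtain x where "v < x" "x \<le> length \<gamma>" "u = ?g ! x"
      "\<And>y. v < y \<Longrightarrow> y \<le> x \<Longrightarrow> ?g ! v < ?g ! y" by blast
    thus "(?g ! v, u) \<in> ?T\<^sup>+"
    proof (induction x arbitrary: u rule: less_induct)
      case (less x)
      have "(brt_parent \<gamma> u, u) \<in> ?T"
      proof -
        have "u \<in> set \<gamma>" using less.prems by (cases x) auto
        thus ?thesis using g by (auto simp: brt_tree_def)
      qed
      then obtain y where y: "y < x" "brt_parent \<gamma> u = ?g ! y" "?g ! y < ?g ! x"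
        "\<And>z. y < z \<Longrightarrow> z < x \<Longrightarrow> ?g ! x < ?g ! z"
        using edge[of x "brt_parent \<gamma> u"] less.prems by auto
      \<comment> \<open>the entry at \<open>v\<close> is itself smaller than the one at \<open>x\<close>, so the parent is not before \<open>v\<close>\<close>
      have "v \<le> y"
      proof (rule ccontr)
        assume "\<not> v \<le> y"
        hence "?g ! x < ?g ! v" using y(4)[of v] less.prems(1) by simp
        thus False using less.prems(4)[of x] less.prems(1) by simp
      qed
      show ?case
      proof (cases "v = y")
        case True
        thus ?thesis using \<open>(brt_parent \<gamma> u, u) \<in> ?T\<close> y(2) by auto
      next
        case False
        have "(?g ! v, ?g ! y) \<in> ?T\<^sup>+"
          using False \<open>v \<le> y\<close> y(1) less.prems(2,4) by (intro less.IH[OF y(1) _ _ refl]) auto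
        thus ?thesis using \<open>(brt_parent \<gamma> u, u) \<in> ?T\<close> y(2) by (metis trancl.trancl_into_trancl)
      qed
    qed
  }
qed

lemma descendants_card_ge_iff:
  assumes g: "distinct \<gamma>" "set \<gamma> = {2..n}" and v: "v \<le> length \<gamma>"
  shows "k \<le> card (descendants (brt_tree n \<gamma>) ((1 # \<gamma>) ! v)) \<longleftrightarrow>
    v + k \<le> length \<gamma> \<and> (\<forall>y. v < y \<longrightarrow> y \<le> v + k \<longrightarrow> (1 # \<gamma>) ! v < (1 # \<gamma>) ! y)"
proof -
  let ?g = "1 # \<gamma>"
  define D where "D = {x. v < x \<and> x \<le> length \<gamma> \<and> (\<forall>y. v < y \<longrightarrow> y \<le> x \<longrightarrow> ?g ! v < ?g ! y)}"
  have dist: "distinct ?g" using g by auto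
  have "descendants (brt_tree n \<gamma>) (?g ! v) = (!) ?g ` D"
    unfolding descendants_def brt_tree_trancl_iff[OF assms] by (auto simp: D_def)
  moreover have "inj_on ((!) ?g) D"
    by (rule inj_on_nth[OF dist]) (auto simp: D_def)
  ultimately have card: "card (descendants (brt_tree n \<gamma>) (?g ! v)) = card D"
    by (simp add: card_image)
  have finD: "finite D" by (rule finite_subset[of _ "{..length \<gamma>}"]) (auto simp: D_def)
  show ?thesis
  proof (cases "k = 0")
    case True
    thus ?thesis using v by simp
  next
    case False
    have "k \<le> card D \<longleftrightarrow> v + k \<in> D"
    proof
      assume "v + k \<in> D"
      hence "{v<..v + k} \<subseteq> D" by (auto simp: D_def)
      from card_mono[OF finD this] show "k \<le> card D" by simp
    next
      assume *: "k \<le> card D"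
      show "v + k \<in> D"
      proof (rule ccontr)
        assume "v + k \<notin> D"
        hence "x < v + k" if "x \<in> D" for x
          using that False by (force simp: D_def not_le)
        hence "D \<subseteq> {v<..<v + k}" by (auto simp: D_def)
        hence "card D \<le> card {v<..<v + k}" by (intro card_mono) auto
        thus False using * False by simp
      qed
    qed
    thus ?thesis using False by (simp only: card D_def mem_Collect_eq) simp
  qed
qed

text \<open>
  The positions of a word of length \<open>m\<close> that are followed by at least \<open>k\<close> letters, the next \<open>k\<close> of
  which are not below the letter in that position.
\<close>

definition low_starts :: "nat \<Rightarrow> nat \<Rightarrow> (nat \<Rightarrow> nat) \<Rightarrow> nat set" where
  "low_starts k m f = {i. i + k < m \<and> (\<forall>j. i < j \<longrightarrow> j \<le> i + k \<longrightarrow> f i \<le> f j)}"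

lemma finite_low_starts [simp]: "finite (low_starts k m f)"
  by (rule finite_subset[of _ "{..<m}"]) (auto simp: low_starts_def)

text \<open>
  The function \<open>f\<close> stands for any word that reproduces the order relations between an entry of the
  arrangement and the later ones. The summand 1 is the root, all \<open>n - 1 \<ge> k\<close> other vertices being
  its descendants.
\<close>

lemma num_nodes_ge_brt_tree:
  assumes g: "distinct \<gamma>" "set \<gamma> = {2..n}" and k: "k < n"
    and f: "\<And>i j. i < j \<Longrightarrow> j < n - 1 \<Longrightarrow> \<gamma> ! i < \<gamma> ! j \<longleftrightarrow> f i \<le> f j"
  shows "num_nodes_ge k n (brt_tree n \<gamma>) = 1 + card (low_starts k (n - 1) f)"
proof -
  let ?g = "1 # \<gamma>"
  have len: "length \<gamma> = n - 1" using distinct_card[OF g(1)] g(2) by simp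
  define G where "G = {v. v + k \<le> length \<gamma> \<and> (\<forall>y. v < y \<longrightarrow> y \<le> v + k \<longrightarrow> ?g ! v < ?g ! y)}"
  have dist: "distinct ?g" using g by auto
  have set: "set ?g = {1..n}" using g(2) k by auto
  have "{v \<in> {1..n}. k \<le> card (descendants (brt_tree n \<gamma>) v)} = (!) ?g ` G"
  proof (intro equalityI subsetI)
    fix c assume c: "c \<in> {v \<in> {1..n}. k \<le> card (descendants (brt_tree n \<gamma>) v)}"
    hence "c \<in> set ?g" using set by blast
    then obtain v where "v < length ?g" "c = ?g ! v" by (metis in_set_conv_nth)
    thus "c \<in> (!) ?g ` G" using c descendants_card_ge_iff[OF g, of v k] by (auto simp: G_def)
  next
    fix c assume "c \<in> (!) ?g ` G"
    then obtain v where v: "v \<in> G" "c = ?g ! v" by blast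
    hence "v \<le> length \<gamma>" by (auto simp: G_def)
    moreover from this have "c \<in> {1..n}" using v(2) set nth_mem[of v ?g] by auto
    ultimately show "c \<in> {v \<in> {1..n}. k \<le> card (descendants (brt_tree n \<gamma>) v)}"
      using v descendants_card_ge_iff[OF g, of v k] by (auto simp: G_def)
  qed
  moreover have "inj_on ((!) ?g) G" by (rule inj_on_nth[OF dist]) (auto simp: G_def)
  ultimately have "num_nodes_ge k n (brt_tree n \<gamma>) = card G"
    by (simp add: num_nodes_ge_def card_image)
  also have "G = insert 0 (Suc ` low_starts k (n - 1) f)"
  proof (intro equalityI subsetI)
    fix v assume v: "v \<in> G"
    show "v \<in> insert 0 (Suc ` low_starts k (n - 1) f)"
    proof (cases v)
      case (Suc i)
      have "f i \<le> f j" if "i < j" "j \<le> i + k" for j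
      proof -
        have "\<And>y. v < y \<Longrightarrow> y \<le> v + k \<Longrightarrow> ?g ! v < ?g ! y"
          using v unfolding G_def by blast
        from this[of "Suc j"] have "?g ! v < ?g ! Suc j" using that Suc by simp
        thus ?thesis using Suc f[of i j] that v len by (simp add: G_def)
      qed
      thus ?thesis using Suc v len by (auto simp: G_def low_starts_def)
    qed simp
  next
    fix v assume v: "v \<in> insert 0 (Suc ` low_starts k (n - 1) f)"
    show "v \<in> G"
    proof (cases v)
      case 0
      have "?g ! 0 < ?g ! y" if "0 < y" "y \<le> k" for y
      proof -
        have "?g ! y \<in> set \<gamma>" using that k len by (cases y) auto
        thus ?thesis using g(2) by auto
      qed
      thus ?thesis using 0 k len by (auto simp: G_def)
    next
      case (Suc i)
      hence i: "i \<in> low_starts k (n - 1) f" using v by auto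
      have "?g ! v < ?g ! y" if y: "v < y" "y \<le> v + k" for y
      proof -
        obtain j where j: "y = Suc j" using y by (cases y) auto
        thus ?thesis using y i f[of i j] Suc by (auto simp: low_starts_def)
      qed
      thus ?thesis using Suc i len by (auto simp: G_def low_starts_def)
    qed
  qed
  also have "card \<dots> = 1 + card (Suc ` low_starts k (n - 1) f)"
    using finite_low_starts by (subst card_insert_disjoint) auto
  also have "card (Suc ` low_starts k (n - 1) f) = card (low_starts k (n - 1) f)"
    by (rule card_image) simp
  finally show ?thesis .
qed

lemma sorted_wrt_filterD:
  assumes "sorted_wrt R (filter P xs)" "i < j" "j < length xs" "P (xs ! i)" "P (xs ! j)"
  shows "R (xs ! i) (xs ! j)"
proof -
  have "xs = take j xs @ drop j xs" by simp
  hence "sorted_wrt R (filter P (take j xs) @ filter P (drop j xs))"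
    using assms(1) by (metis filter_append)
  moreover have "xs ! i \<in> set (filter P (take j xs))"
    using assms(2-4) by (auto simp: in_set_conv_nth intro!: exI[of _ i])
  moreover have "xs ! j \<in> set (filter P (drop j xs))"
    using assms(3,5) by (auto simp: in_set_conv_nth intro!: exI[of _ 0])
  ultimately show ?thesis by (auto simp: sorted_wrt_append)
qed

lemma interleaving_less_iff:
  assumes b: "b \<in> weak_compositions {1..a} (n - 1)" and g: "\<gamma> \<in> interleavings n a b"
    and ij: "i < j" "j < n - 1"
  shows "\<gamma> ! i < \<gamma> ! j \<longleftrightarrow> pile_index b (\<gamma> ! i) \<le> pile_index b (\<gamma> ! j)"
proof -
  have d: "distinct \<gamma>" "set \<gamma> = {2..n}"
    using g by (auto simp: interleavings_def permutations_of_set_def)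
  have len: "length \<gamma> = n - 1" using distinct_card[OF d(1)] d(2) by simp
  have tot: "(\<Sum>u\<in>{1..a}. b u) = n - 1" using b by (simp add: weak_compositions_def)
  have bound: "\<gamma> ! x < 2 + (\<Sum>u\<in>{1..a}. b u)" if "x < n - 1" for x
    using that len d(2) nth_mem[of x \<gamma>] unfolding tot by auto
  have eq: "\<gamma> ! i < \<gamma> ! j" if "pile_index b (\<gamma> ! i) = pile_index b (\<gamma> ! j)"
  proof (rule sorted_wrt_filterD[where P = "\<lambda>c. pile_index b c = pile_index b (\<gamma> ! j)"])
    have "filter (\<lambda>c. pile_index b c = pile_index b (\<gamma> ! j)) \<gamma> = pile b (pile_index b (\<gamma> ! j))"
      using g interleavings_iff[OF b] by blast
    thus "sorted_wrt (<) (filter (\<lambda>c. pile_index b c = pile_index b (\<gamma> ! j)) \<gamma>)"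
      by (simp only: pile_def sorted_wrt_upt)
  qed (use that ij len in auto)
  show ?thesis
    using eq pile_index_less[OF bound, of i "\<gamma> ! j"] pile_index_less[OF bound, of j "\<gamma> ! i"] ij
    by (cases "pile_index b (\<gamma> ! i)" "pile_index b (\<gamma> ! j)" rule: linorder_cases) auto
qed

lemma brt_node_count_iid:
  assumes p: "prob_vector a p" and n: "k < n"
  shows "map_pmf (num_nodes_ge k n) (brt_pmf n a p)
       = map_pmf (\<lambda>f. 1 + card (low_starts k (n - 1) f)) (iid_pmf (n - 1) (letter_pmf a p))"
proof -
  let ?M = "multinomial_pmf a (n - 1) p"
  let ?I = "\<lambda>b. pmf_of_set (interleavings n a b)"
  let ?h = "\<lambda>w :: nat list. 1 + card (low_starts k (n - 1) (\<lambda>i. if i < n - 1 then w ! i else 0))"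
  have "map_pmf (num_nodes_ge k n) (brt_pmf n a p)
      = bind_pmf ?M (\<lambda>b. map_pmf (\<lambda>\<gamma>. num_nodes_ge k n (brt_tree n \<gamma>)) (?I b))"
    by (simp add: brt_pmf_def riffle_pmf_def map_bind_pmf pmf.map_comp o_def)
  also have "\<dots> = bind_pmf ?M (\<lambda>b. map_pmf ?h (map_pmf (map (pile_index b)) (?I b)))"
  proof (rule bind_pmf_cong[OF refl])
    fix b assume "b \<in> set_pmf ?M"
    hence b: "b \<in> weak_compositions {1..a} (n - 1)"
      by (auto simp: set_pmf_iff pmf_multinomial_pmf[OF p] split: if_splits)
    show "map_pmf (\<lambda>\<gamma>. num_nodes_ge k n (brt_tree n \<gamma>)) (?I b)
        = map_pmf ?h (map_pmf (map (pile_index b)) (?I b))"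
      unfolding pmf.map_comp o_def
    proof (rule map_pmf_cong[OF refl])
      fix \<gamma> assume "\<gamma> \<in> set_pmf (?I b)"
      hence g: "\<gamma> \<in> interleavings n a b"
        using interleavings_nonempty[OF b] finite_interleavings by simp
      have d: "distinct \<gamma>" "set \<gamma> = {2..n}"
        using g by (auto simp: interleavings_def permutations_of_set_def)
      have len: "length \<gamma> = n - 1" using distinct_card[OF d(1)] d(2) by simp
      show "num_nodes_ge k n (brt_tree n \<gamma>) = ?h (map (pile_index b) \<gamma>)"
        using n interleaving_less_iff[OF b g] len
        by (intro num_nodes_ge_brt_tree[OF d]) auto
    qed
  qed
  also have "\<dots> = map_pmf ?h (map_pmf (\<lambda>f. map f [0..<n - 1]) (iid_pmf (n - 1) (letter_pmf a p)))"
    unfolding riffle_words_iid[OF p, symmetric] map_bind_pmf ..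
  also have "\<dots> = map_pmf (\<lambda>f. 1 + card (low_starts k (n - 1) f)) (iid_pmf (n - 1) (letter_pmf a p))"
    unfolding pmf.map_comp o_def
  proof (rule map_pmf_cong[OF refl])
    fix f :: "nat \<Rightarrow> nat"
    have "low_starts k (n - 1) (\<lambda>i. if i < n - 1 then map f [0..<n - 1] ! i else 0)
        = low_starts k (n - 1) f"
      by (auto simp: low_starts_def)
    thus "?h (map f [0..<n - 1]) = 1 + card (low_starts k (n - 1) f)" by simp
  qed
  finally show ?thesis .
qed

section \<open>The variance for an i.i.d. word\<close>

text \<open>
  The event that none of the \<open>k\<close> letters after position \<open>i\<close> is below the letter at \<open>i\<close>. For
  \<open>i + k < m\<close> it is the event \<open>i \<in> low_starts k m f\<close>.
\<close>

definition low_event :: "nat \<Rightarrow> nat \<Rightarrow> (nat \<Rightarrow> nat) set" where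
  "low_event k i = {f. \<forall>j. i < j \<longrightarrow> j \<le> i + k \<longrightarrow> f i \<le> f j}"

lemma prob_iid_box:
  assumes "J \<subseteq> {..<m}"
  shows "measure (iid_pmf m D) {f. \<forall>j\<in>J. f j \<in> B j} = (\<Prod>j\<in>J. measure D (B j))"
proof -
  have "{f. \<forall>j\<in>J. f j \<in> B j} = Pi {..<m} (\<lambda>j. if j \<in> J then B j else UNIV)"
    using assms by (auto simp: Pi_def split: if_splits)
  hence "measure (iid_pmf m D) {f. \<forall>j\<in>J. f j \<in> B j}
      = (\<Prod>j<m. measure D (if j \<in> J then B j else UNIV))"
    by (simp add: measure_Pi_pmf_Pi)
  also have "\<dots> = (\<Prod>j\<in>J. measure D (if j \<in> J then B j else UNIV))"
    using assms by (intro prod.mono_neutral_right) auto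
  also have "\<dots> = (\<Prod>j\<in>J. measure D (B j))" by (intro prod.cong) auto
  finally show ?thesis .
qed

lemma prob_iid_one_low:
  assumes "insert i A \<subseteq> {..<m}" "i \<notin> A"
  shows "measure (iid_pmf m D) {f. f i = s \<and> (\<forall>j\<in>A. s \<le> f j)} = pmf D s * measure D {s..} ^ card A"
proof -
  define B where "B = (\<lambda>j. if j = i then {s} else {s..})"
  have fin: "finite A" using assms(1) by (auto intro: finite_subset)
  have "{f. f i = s \<and> (\<forall>j\<in>A. s \<le> f j)} = {f. \<forall>j\<in>insert i A. f j \<in> B j}"
    using assms(2) by (auto simp: B_def)
  also have "measure (iid_pmf m D) \<dots> = (\<Prod>j\<in>insert i A. measure D (B j))"
    by (rule prob_iid_box[OF assms(1)])
  also have "\<dots> = measure D (B i) * (\<Prod>j\<in>A. measure D (B j))"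
    using fin assms(2) by simp
  also have "(\<Prod>j\<in>A. measure D (B j)) = (\<Prod>j\<in>A. measure D {s..})"
    using assms(2) by (intro prod.cong) (auto simp: B_def)
  finally show ?thesis by (simp add: B_def measure_pmf_single)
qed

text \<open>
  Two disjoint blocks of positions \<open>insert i A\<close> and \<open>insert u A'\<close>: each has a prescribed letter at
  its distinguished position and no smaller letters elsewhere.
\<close>

lemma prob_iid_two_low:
  assumes "insert i A \<union> insert u A' \<subseteq> {..<m}" "i \<notin> A" "u \<notin> A'"
    and "insert i A \<inter> insert u A' = {}"
  shows "measure (iid_pmf m D)
           {f. f i = s \<and> (\<forall>j\<in>A. s \<le> f j) \<and> f u = r \<and> (\<forall>j\<in>A'. r \<le> f j)}
         = (pmf D s * measure D {s..} ^ card A) * (pmf D r * measure D {r..} ^ card A')"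
proof -
  define B where "B = (\<lambda>j. if j = i then {s} else if j \<in> A then {s..} else if j = u then {r} else {r..})"
  have fin: "finite A" "finite A'" using assms(1) by (auto intro: finite_subset)
  have "{f. f i = s \<and> (\<forall>j\<in>A. s \<le> f j) \<and> f u = r \<and> (\<forall>j\<in>A'. r \<le> f j)}
      = {f. \<forall>j\<in>insert i A \<union> insert u A'. f j \<in> B j}"
  proof (intro Collect_cong)
    fix f :: "nat \<Rightarrow> nat"
    have "(\<forall>j\<in>A. f j \<in> B j) \<longleftrightarrow> (\<forall>j\<in>A. s \<le> f j)"
      using assms(2) by (intro ball_cong) (auto simp: B_def)
    moreover have "(\<forall>j\<in>A'. f j \<in> B j) \<longleftrightarrow> (\<forall>j\<in>A'. r \<le> f j)"
      using assms(3,4) by (intro ball_cong) (auto simp: B_def)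
    moreover have "f i \<in> B i \<longleftrightarrow> f i = s" "f u \<in> B u \<longleftrightarrow> f u = r"
      using assms(4) by (auto simp: B_def)
    ultimately show "(f i = s \<and> (\<forall>j\<in>A. s \<le> f j) \<and> f u = r \<and> (\<forall>j\<in>A'. r \<le> f j))
        = (\<forall>j\<in>insert i A \<union> insert u A'. f j \<in> B j)"
      by (auto simp only: ball_Un ball_simps)
  qed
  also have "measure (iid_pmf m D) \<dots> = (\<Prod>j\<in>insert i A \<union> insert u A'. measure D (B j))"
    by (rule prob_iid_box[OF assms(1)])
  also have "\<dots> = (measure D (B i) * (\<Prod>j\<in>A. measure D (B j)))
                  * (measure D (B u) * (\<Prod>j\<in>A'. measure D (B j)))"
    using fin assms(2-4) by (subst prod.union_disjoint) auto
  also have "(\<Prod>j\<in>A. measure D (B j)) = (\<Prod>j\<in>A. measure D {s..})"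
    using assms(2) by (intro prod.cong) (auto simp: B_def)
  also have "(\<Prod>j\<in>A'. measure D (B j)) = (\<Prod>j\<in>A'. measure D {r..})"
    using assms(3,4) by (intro prod.cong) (auto simp: B_def)
  also have "B i = {s}" by (simp add: B_def)
  also have "B u = {r}" using assms(4) by (auto simp: B_def)
  finally show ?thesis by (simp add: measure_pmf_single)
qed

lemma prob_iid_split:
  assumes D: "set_pmf D \<subseteq> R" "finite R" and i: "i < m"
  shows "measure (iid_pmf m D) E = (\<Sum>s\<in>R. measure (iid_pmf m D) {f \<in> E. f i = s})"
proof -
  let ?\<mu> = "iid_pmf m D"
  have "f i \<in> R" if "f \<in> set_pmf ?\<mu>" for f
    using that D(1) i by (auto simp: set_Pi_pmf PiE_dflt_def)
  hence "measure ?\<mu> E = measure ?\<mu> (\<Union>s\<in>R. {f \<in> E. f i = s})"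
    by (intro measure_prob_cong_0) (auto simp: set_pmf_iff)
  also have "\<dots> = (\<Sum>s\<in>R. measure ?\<mu> {f \<in> E. f i = s})"
    using D(2) by (intro measure_pmf.finite_measure_finite_Union) (auto simp: disjoint_family_on_def)
  finally show ?thesis .
qed

text \<open>
  In what follows \<open>R\<close> is a finite set of letters that carries \<open>D\<close>, and \<open>T s\<close> is the probability that
  a position has a letter \<open>\<ge> s\<close> and is followed by \<open>k\<close> letters not below its own.
\<close>

context
  fixes D :: "nat pmf" and R :: "nat set" and k :: nat and T :: "nat \<Rightarrow> real"
  assumes R: "set_pmf D \<subseteq> R" "finite R"
  defines "T \<equiv> \<lambda>s. \<Sum>r\<in>{r \<in> R. s \<le> r}. pmf D r * measure D {r..} ^ k"
begin

lemma prob_low_event: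
  assumes "i + k < m"
  shows "measure (iid_pmf m D) (low_event k i) = (\<Sum>s\<in>R. pmf D s * measure D {s..} ^ k)"
proof -
  have *: "{f \<in> low_event k i. f i = s} = {f. f i = s \<and> (\<forall>j\<in>{i<..i + k}. s \<le> f j)}" for s
    by (auto simp: low_event_def)
  have "measure (iid_pmf m D) {f \<in> low_event k i. f i = s} = pmf D s * measure D {s..} ^ k" for s
  proof -
    have "insert i {i<..i + k} \<subseteq> {..<m}" using assms by auto
    thus ?thesis using * prob_iid_one_low[of i "{i<..i + k}" m D s] by simp
  qed
  thus ?thesis using assms prob_iid_split[OF R, of i m "low_event k i"] by simp
qed

lemma prob_low_event_far:
  assumes "i + k < u" "u + k < m"
  shows "measure (iid_pmf m D) (low_event k i \<inter> low_event k u)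
           = (\<Sum>s\<in>R. pmf D s * measure D {s..} ^ k)\<^sup>2"
proof -
  let ?E = "low_event k i \<inter> low_event k u"
  let ?\<mu> = "iid_pmf m D"
  have "{f \<in> {f \<in> ?E. f i = s}. f u = r}
      = {f. f i = s \<and> (\<forall>j\<in>{i<..i + k}. s \<le> f j) \<and> f u = r \<and> (\<forall>j\<in>{u<..u + k}. r \<le> f j)}" for s r
    by (auto simp: low_event_def)
  moreover have "insert i {i<..i + k} \<union> insert u {u<..u + k} \<subseteq> {..<m}"
    "insert i {i<..i + k} \<inter> insert u {u<..u + k} = {}" using assms by auto
  ultimately have *: "measure ?\<mu> {f \<in> {f \<in> ?E. f i = s}. f u = r}
      = (pmf D s * measure D {s..} ^ k) * (pmf D r * measure D {r..} ^ k)" for s r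
    using prob_iid_two_low[of i "{i<..i + k}" u "{u<..u + k}" m D s r] by simp
  have "measure ?\<mu> ?E = (\<Sum>s\<in>R. \<Sum>r\<in>R. measure ?\<mu> {f \<in> {f \<in> ?E. f i = s}. f u = r})"
    using assms
    by (subst prob_iid_split[OF R, of i], simp,
        intro sum.cong refl prob_iid_split[OF R, of u]) simp
  thus ?thesis unfolding * by (simp add: power2_eq_square sum_product)
qed

text \<open>
  Given letter \<open>s\<close> at \<open>i\<close> and letter \<open>r \<ge> s\<close> at \<open>i + d\<close>, the first event constrains only the
  \<open>d - 1\<close> positions in between, the later ones being governed by the second event.
\<close>

lemma prob_low_event_near:
  assumes "1 \<le> d" "d \<le> k" "i + d + k < m"
  shows "measure (iid_pmf m D) (low_event k i \<inter> low_event k (i + d))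
           = (\<Sum>s\<in>R. pmf D s * measure D {s..} ^ (d - 1) * T s)"
proof -
  define u where "u = i + d"
  let ?E = "low_event k i \<inter> low_event k u"
  let ?\<mu> = "iid_pmf m D"
  have *: "measure ?\<mu> {f \<in> {f \<in> ?E. f i = s}. f u = r} = (if s \<le> r then
      (pmf D s * measure D {s..} ^ (d - 1)) * (pmf D r * measure D {r..} ^ k) else 0)" for s r
  proof (cases "s \<le> r")
    case True
    have "{f \<in> {f \<in> ?E. f i = s}. f u = r}
      = {f. f i = s \<and> (\<forall>j\<in>{i<..<u}. s \<le> f j) \<and> f u = r \<and> (\<forall>j\<in>{u<..u + k}. r \<le> f j)}"
      (is "?L = ?R")
    proof (intro equalityI subsetI)
      fix f assume "f \<in> ?L"
      thus "f \<in> ?R" using assms by (auto simp: low_event_def u_def)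
    next
      fix f assume f: "f \<in> ?R"
      have "s \<le> f j" if "i < j" "j \<le> i + k" for j
      proof (cases j u rule: linorder_cases)
        case greater
        hence "r \<le> f j" using f that by (auto simp: u_def)
        thus ?thesis using True by simp
      qed (use f that True in auto)
      thus "f \<in> ?L" using f by (auto simp: low_event_def)
    qed
    moreover have "insert i {i<..<u} \<union> insert u {u<..u + k} \<subseteq> {..<m}"
      "insert i {i<..<u} \<inter> insert u {u<..u + k} = {}" using assms by (auto simp: u_def)
    moreover have "card {i<..<u} = d - 1" by (simp add: u_def)
    ultimately show ?thesis
      using True prob_iid_two_low[of i "{i<..<u}" u "{u<..u + k}" m D s r] by simp
  next
    case False
    hence "{f \<in> {f \<in> ?E. f i = s}. f u = r} = {}"
      using assms by (auto simp: low_event_def u_def)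
    thus ?thesis using False by (simp only: measure_empty if_False)
  qed
  have "measure ?\<mu> ?E = (\<Sum>s\<in>R. \<Sum>r\<in>R. measure ?\<mu> {f \<in> {f \<in> ?E. f i = s}. f u = r})"
    using assms
    by (subst prob_iid_split[OF R, of i], simp,
        intro sum.cong refl prob_iid_split[OF R, of u]) (simp add: u_def)
  also have "\<dots> = (\<Sum>s\<in>R. pmf D s * measure D {s..} ^ (d - 1) * T s)"
    unfolding * T_def sum_distrib_left
    by (rule sum.cong[OF refl], rule sum.mono_neutral_cong_right) (use R(2) in auto)
  finally show ?thesis by (simp only: u_def)
qed

end

lemma variance_count_events:
  fixes M :: "'b pmf" and E :: "nat \<Rightarrow> 'b set"
  shows "measure_pmf.variance M (\<lambda>x. c + (\<Sum>i<N. indicator (E i) x)) =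
    (\<Sum>i<N. \<Sum>j<N. measure M (E i \<inter> E j) - measure M (E i) * measure M (E j))"
proof -
  let ?Z = "\<lambda>x. \<Sum>i<N. indicator (E i) x :: real"
  have int: "integrable M (indicator A :: _ \<Rightarrow> real)" for A
    by (intro measure_pmf.integrable_const_bound[of _ 1]) (auto simp: indicator_def)
  have sq: "(?Z x)\<^sup>2 = (\<Sum>i<N. \<Sum>j<N. indicator (E i \<inter> E j) x)" for x
    by (simp add: power2_eq_square sum_product indicator_inter_arith)
  have EZ: "measure_pmf.expectation M ?Z = (\<Sum>i<N. measure M (E i))"
    using int by (simp add: Bochner_Integration.integral_sum)
  have "measure_pmf.expectation M (\<lambda>x. c + ?Z x) = c + measure_pmf.expectation M ?Z"
    using int by (subst Bochner_Integration.integral_add) auto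
  hence "measure_pmf.variance M (\<lambda>x. c + ?Z x) = measure_pmf.variance M ?Z" by simp
  also have "\<dots> = measure_pmf.expectation M (\<lambda>x. (?Z x)\<^sup>2) - (measure_pmf.expectation M ?Z)\<^sup>2"
    by (rule measure_pmf.variance_eq) (simp_all add: sq int)
  also have "measure_pmf.expectation M (\<lambda>x. (?Z x)\<^sup>2) = (\<Sum>i<N. \<Sum>j<N. measure M (E i \<inter> E j))"
    unfolding sq using int by (simp add: Bochner_Integration.integral_sum)
  also have "\<dots> - (measure_pmf.expectation M ?Z)\<^sup>2
      = (\<Sum>i<N. \<Sum>j<N. measure M (E i \<inter> E j) - measure M (E i) * measure M (E j))"
    unfolding EZ by (simp add: power2_eq_square sum_product sum_subtractf)
  finally show ?thesis .
qed

text \<open>Each distance \<open>d \<ge> 1\<close> is realised by \<open>N - d\<close> unordered pairs of positions below \<open>N\<close>.\<close>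

lemma sum_square_by_distance:
  fixes c :: "nat \<Rightarrow> nat \<Rightarrow> real"
  assumes "\<And>i j. c i j = c j i" "\<And>i d. i + d < N \<Longrightarrow> c i (i + d) = h d"
  shows "(\<Sum>i<N. \<Sum>j<N. c i j) = real N * h 0 + 2 * (\<Sum>d=1..N. (real N - real d) * h d)"
  using assms(2)
proof (induction N)
  case 0
  thus ?case by simp
next
  case (Suc N)
  have IH: "(\<Sum>i<N. \<Sum>j<N. c i j) = real N * h 0 + 2 * (\<Sum>d=1..N. (real N - real d) * h d)"
    using Suc.prems by (intro Suc.IH) simp
  have border: "(\<Sum>i<N. c i N) = (\<Sum>d=1..N. h d)"
  proof -
    have "(\<Sum>i<N. c i N) = (\<Sum>i<N. h (N - i))"
    proof (intro sum.cong refl)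
      fix i assume "i \<in> {..<N}"
      thus "c i N = h (N - i)" using Suc.prems[of i "N - i"] by simp
    qed
    also have "\<dots> = (\<Sum>d=1..N. h d)"
      by (rule sum.reindex_bij_witness[of _ "\<lambda>d. N - d" "\<lambda>i. N - i"]) auto
    finally show ?thesis .
  qed
  have "(\<Sum>j<N. c N j) = (\<Sum>i<N. c i N)" by (intro sum.cong refl assms(1))
  hence "(\<Sum>i<Suc N. \<Sum>j<Suc N. c i j)
      = (\<Sum>i<N. \<Sum>j<N. c i j) + 2 * (\<Sum>i<N. c i N) + c N N"
    by (simp add: sum.distrib)
  moreover have "c N N = h 0" using Suc.prems[of N 0] by simp
  moreover have "(\<Sum>d=1..Suc N. (real (Suc N) - real d) * h d)
      = (\<Sum>d=1..N. (real N - real d) * h d) + (\<Sum>d=1..N. h d)"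
    by (simp add: sum.distrib[symmetric] algebra_simps)
  ultimately show ?case unfolding IH border by (simp add: algebra_simps)
qed

text \<open>
  The assumption \<open>2 * k \<le> m\<close> makes \<open>N - d\<close> nonnegative for all \<open>d \<le> k\<close>, so that it is the true
  number of pairs at distance \<open>d\<close>.
\<close>

lemma variance_card_low_starts:
  fixes D :: "nat pmf"
  assumes R: "set_pmf D \<subseteq> R" "finite R" and m: "2 * k \<le> m"
  defines "T \<equiv> \<lambda>s. \<Sum>r\<in>{r \<in> R. s \<le> r}. pmf D r * measure D {r..} ^ k"
    and "S \<equiv> \<Sum>s\<in>R. pmf D s * measure D {s..} ^ k"
    and "N \<equiv> real m - real k"
  shows "measure_pmf.variance (iid_pmf m D) (\<lambda>f. real (1 + card (low_starts k m f)))
    = N * (S - S\<^sup>2) + 2 * (\<Sum>d=1..k. (N - real d) *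
        ((\<Sum>s\<in>R. pmf D s * measure D {s..} ^ (d - 1) * T s) - S\<^sup>2))"
proof -
  let ?\<mu> = "iid_pmf m D"
  let ?N = "m - k"
  define G where "G = (\<lambda>d. \<Sum>s\<in>R. pmf D s * measure D {s..} ^ (d - 1) * T s)"
  \<comment> \<open>the covariance of two indicators at distance \<open>d\<close>\<close>
  define h where "h = (\<lambda>d. if d = 0 then S - S\<^sup>2 else if d \<le> k then G d - S\<^sup>2 else 0)"
  have N: "real ?N = N" using m by (simp add: N_def)
  have "real (1 + card (low_starts k m f)) = 1 + (\<Sum>i<?N. indicator (low_event k i) f)" for f
  proof -
    have "(\<Sum>i<?N. indicator (low_event k i) f :: real) = (\<Sum>i\<in>low_starts k m f. 1)"
      by (intro sum.mono_neutral_cong_right) (auto simp: low_starts_def low_event_def indicator_def)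
    thus ?thesis by simp
  qed
  hence "measure_pmf.variance ?\<mu> (\<lambda>f. real (1 + card (low_starts k m f)))
      = (\<Sum>i<?N. \<Sum>j<?N. measure ?\<mu> (low_event k i \<inter> low_event k j)
            - measure ?\<mu> (low_event k i) * measure ?\<mu> (low_event k j))"
    by (simp only: variance_count_events)
  also have "\<dots> = real ?N * h 0 + 2 * (\<Sum>d=1..?N. (real ?N - real d) * h d)"
  proof (rule sum_square_by_distance)
    fix i d assume id: "i + d < ?N"
    have single: "measure ?\<mu> (low_event k i) = S" "measure ?\<mu> (low_event k (i + d)) = S"
      using id unfolding S_def by (auto intro!: prob_low_event[OF R])
    have "measure ?\<mu> (low_event k i \<inter> low_event k (i + d)) = G d" if "1 \<le> d" "d \<le> k"
      unfolding G_def T_def using id that by (intro prob_low_event_near[OF R]) auto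
    moreover have "measure ?\<mu> (low_event k i \<inter> low_event k (i + d)) = S\<^sup>2" if "k < d"
      unfolding S_def using id that by (intro prob_low_event_far[OF R]) auto
    ultimately show "measure ?\<mu> (low_event k i \<inter> low_event k (i + d))
        - measure ?\<mu> (low_event k i) * measure ?\<mu> (low_event k (i + d)) = h d"
      using single by (cases "d = 0") (auto simp: h_def power2_eq_square not_le)
  qed (simp add: Int_commute mult.commute)
  also have "(\<Sum>d=1..?N. (real ?N - real d) * h d) = (\<Sum>d=1..k. (real ?N - real d) * (G d - S\<^sup>2))"
    using m by (intro sum.mono_neutral_cong_right) (auto simp: h_def)
  finally show ?thesis unfolding N by (simp add: h_def G_def)
qed

lemma sum_arith_geometric:
  fixes q N :: real
  assumes "q \<noteq> 1"
  shows "(\<Sum>d=1..k. (N - real d) * q ^ (d - 1))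
       = (N - (N - real k) * q ^ k - (1 - q ^ k) / (1 - q)) / (1 - q)"
proof -
  have "(1 - q)\<^sup>2 * (\<Sum>d=1..k. (N - real d) * q ^ (d - 1))
      = N * (1 - q) - (N - real k) * q ^ k * (1 - q) - (1 - q ^ k)"
    by (induction k) (simp_all add: algebra_simps power2_eq_square)
  hence "(\<Sum>d=1..k. (N - real d) * q ^ (d - 1))
      = (N * (1 - q) - (N - real k) * q ^ k * (1 - q) - (1 - q ^ k)) / (1 - q)\<^sup>2"
    using assms by (simp add: eq_divide_eq mult.commute)
  also have "\<dots> = (N - (N - real k) * q ^ k - (1 - q ^ k) / (1 - q)) / (1 - q)"
    using assms by (simp add: divide_simps power2_eq_square left_diff_distrib)
  finally show ?thesis .
qed

section \<open>The variance of the number of nodes\<close>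

lemma prob_letter_ge:
  assumes p: "prob_vector a p" and s: "1 \<le> s"
  shows "measure (letter_pmf a p) {s..} = (\<Sum>u=s..a. p u)"
proof -
  have "measure (letter_pmf a p) {s..} = measure (letter_pmf a p) {s..a}"
    by (rule measure_prob_cong_0) (auto simp: pmf_letter_pmf[OF p])
  also have "\<dots> = (\<Sum>u=s..a. pmf (letter_pmf a p) u)" by (simp add: measure_measure_pmf_finite)
  also have "\<dots> = (\<Sum>u=s..a. p u)" using s by (intro sum.cong) (auto simp: pmf_letter_pmf[OF p])
  finally show ?thesis .
qed

lemma variance_brt_covariance_form:
  fixes a k n :: nat and p :: "nat \<Rightarrow> real"
  assumes p: "prob_vector a p" and n: "2 * k + 1 \<le> n"
  defines "q \<equiv> \<lambda>s. \<Sum>u=s..a. p u"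
  defines "T \<equiv> \<lambda>s. \<Sum>r=s..a. p r * q r ^ k"
    and "N \<equiv> real n - real k - 1"
  shows "measure_pmf.variance (brt_pmf n a p) (\<lambda>T. real (num_nodes_ge k n T))
    = N * (T 1 - (T 1)\<^sup>2) + 2 * (\<Sum>d=1..k. (N - real d) *
        ((\<Sum>s=1..a. p s * q s ^ (d - 1) * T s) - (T 1)\<^sup>2))"
proof -
  let ?D = "letter_pmf a p"
  let ?\<mu> = "iid_pmf (n - 1) ?D"
  have supp: "set_pmf ?D \<subseteq> {1..a}"
    by (auto simp: set_pmf_iff pmf_letter_pmf[OF p] split: if_splits)
  have q: "measure ?D {s..} = q s" if "s \<in> {1..a}" for s
    using that prob_letter_ge[OF p, of s] by (simp add: q_def)
  have d: "pmf ?D s = p s" if "s \<in> {1..a}" for s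
    using that by (simp add: pmf_letter_pmf[OF p])
  have T: "(\<Sum>r\<in>{r \<in> {1..a}. s \<le> r}. pmf ?D r * measure ?D {r..} ^ k) = T s"
    if "s \<in> {1..a}" for s
    unfolding T_def using that by (intro sum.cong) (auto simp: q d)
  have S: "(\<Sum>s\<in>{1..a}. pmf ?D s * measure ?D {s..} ^ k) = T 1"
    unfolding T_def by (intro sum.cong refl) (simp add: q d)
  have G: "(\<Sum>s\<in>{1..a}. pmf ?D s * measure ?D {s..} ^ (e - 1) *
        (\<Sum>r\<in>{r \<in> {1..a}. s \<le> r}. pmf ?D r * measure ?D {r..} ^ k))
      = (\<Sum>s=1..a. p s * q s ^ (e - 1) * T s)" for e
    by (intro sum.cong refl) (simp only: T q d)
  have "measure_pmf.variance (brt_pmf n a p) (\<lambda>T. real (num_nodes_ge k n T))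
      = measure_pmf.variance (map_pmf (num_nodes_ge k n) (brt_pmf n a p)) real"
    by simp
  also have "\<dots> = measure_pmf.variance
      (map_pmf (\<lambda>f. 1 + card (low_starts k (n - 1) f)) ?\<mu>) real"
    using n by (simp only: brt_node_count_iid[OF p, of k n])
  also have "\<dots> = measure_pmf.variance ?\<mu> (\<lambda>f. real (1 + card (low_starts k (n - 1) f)))"
    by (simp only: integral_map_pmf)
  also have "\<dots> = (real (n - 1) - real k) * (T 1 - (T 1)\<^sup>2) + 2 * (\<Sum>d=1..k.
      (real (n - 1) - real k - real d) * ((\<Sum>s=1..a. p s * q s ^ (d - 1) * T s) - (T 1)\<^sup>2))"
    using variance_card_low_starts[OF supp, of k "n - 1"] n unfolding S G by simp
  also have "real (n - 1) - real k = N" using n by (simp add: N_def)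
  finally show ?thesis .
qed

lemma variance_brt_closed_form:
  fixes a k n :: nat and p :: "nat \<Rightarrow> real"
  assumes p: "prob_vector a p" and pos: "\<forall>s\<in>{1..a}. 0 < p s" and n: "2 * k + 1 \<le> n"
  defines "q \<equiv> \<lambda>s. \<Sum>u=s..a. p u"
  defines "T \<equiv> \<lambda>s. \<Sum>r=s..a. p r * q r ^ k"
  shows "measure_pmf.variance (brt_pmf n a p) (\<lambda>T. real (num_nodes_ge k n T)) =
      T 1 * ((real n - real k - 1) + p 1 * (2 * real n * real k - 3 * real k * (real k + 1)))
      + 2 * (\<Sum>s=2..a. p s * (1 / (\<Sum>u=1..s-1. p u)) * T s
          * (real n - real k - 1 - (real n - 2 * real k - 1) * q s ^ k
             - (1 - q s ^ k) / (1 - q s)))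
      - (T 1)\<^sup>2 * (real n * (2 * real k + 1) - (3 * real k + 1) * (real k + 1))"
proof -
  define N where "N = real n - real k - 1"
  \<comment> \<open>the sum over the distances, for a fixed letter \<open>s\<close> at the first position\<close>
  define W where "W = (\<lambda>s. \<Sum>d=1..k. (N - real d) * q s ^ (d - 1))"
  have q1: "q 1 = 1" using p by (simp add: q_def prob_vector_def)
  have a: "1 \<le> a"
    using p by (cases a) (auto simp: prob_vector_def)
  have lin: "(\<Sum>d=1..j. N - real d) = real j * N - real j * (real j + 1) / 2" for j
    by (induction j) (auto simp: field_simps)
  have W1: "W 1 = real k * N - real k * (real k + 1) / 2"
    unfolding W_def q1 using lin[of k] by simp
  have Ws: "p s * W s * T s = p s * (1 / (\<Sum>u=1..s-1. p u)) * T s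
      * (real n - real k - 1 - (real n - 2 * real k - 1) * q s ^ k - (1 - q s ^ k) / (1 - q s))"
    if s: "s \<in> {2..a}" for s
  proof -
    have "{1..a} = {1..s-1} \<union> {s..a}" "{1..s-1} \<inter> {s..a} = {}" using s by auto
    hence "(\<Sum>u=1..a. p u) = (\<Sum>u=1..s-1. p u) + q s"
      unfolding q_def by (simp add: sum.union_disjoint)
    hence c: "1 - q s = (\<Sum>u=1..s-1. p u)" using p by (simp add: prob_vector_def)
    have "0 < (\<Sum>u=1..s-1. p u)" using s pos by (intro sum_pos) auto
    hence "q s \<noteq> 1" using c by simp
    hence "W s = (N - (N - real k) * q s ^ k - (1 - q s ^ k) / (1 - q s)) / (1 - q s)"
      unfolding W_def by (rule sum_arith_geometric)
    thus ?thesis unfolding c[symmetric] N_def by (simp add: mult_ac)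
  qed
  have "(\<Sum>d=1..k. (N - real d) * ((\<Sum>s=1..a. p s * q s ^ (d - 1) * T s) - (T 1)\<^sup>2))
      = (\<Sum>d=1..k. \<Sum>s=1..a. (N - real d) * (p s * q s ^ (d - 1) * T s))
        - (\<Sum>d=1..k. N - real d) * (T 1)\<^sup>2"
    by (subst sum_distrib_right) (simp only: right_diff_distrib sum_subtractf sum_distrib_left)
  also have "(\<Sum>d=1..k. \<Sum>s=1..a. (N - real d) * (p s * q s ^ (d - 1) * T s))
      = (\<Sum>s=1..a. p s * W s * T s)"
    unfolding W_def by (subst sum.swap) (simp add: sum_distrib_left sum_distrib_right mult_ac)
  also have "\<dots> = p 1 * W 1 * T 1 + (\<Sum>s=2..a. p s * W s * T s)"
    using sum.atLeast_Suc_atMost[OF a, of "\<lambda>s. p s * W s * T s"] by (simp add: numeral_2_eq_2)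
  also have "(\<Sum>s=2..a. p s * W s * T s)
      = (\<Sum>s=2..a. p s * (1 / (\<Sum>u=1..s-1. p u)) * T s
          * (real n - real k - 1 - (real n - 2 * real k - 1) * q s ^ k
             - (1 - q s ^ k) / (1 - q s)))" (is "_ = ?X")
    by (intro sum.cong refl Ws)
  finally have *: "(\<Sum>d=1..k. (N - real d) * ((\<Sum>s=1..a. p s * q s ^ (d - 1) * T s) - (T 1)\<^sup>2))
      = p 1 * W 1 * T 1 + ?X - (\<Sum>d=1..k. N - real d) * (T 1)\<^sup>2" .
  have "measure_pmf.variance (brt_pmf n a p) (\<lambda>T. real (num_nodes_ge k n T))
      = N * (T 1 - (T 1)\<^sup>2) + 2 * (p 1 * W 1 * T 1 + ?X - (\<Sum>d=1..k. N - real d) * (T 1)\<^sup>2)"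
    unfolding *[symmetric] unfolding N_def T_def q_def
    by (rule variance_brt_covariance_form[OF p n])
  also have "\<dots> = T 1 * (N + p 1 * (2 * real k * N - real k * (real k + 1))) + 2 * ?X
      - (T 1)\<^sup>2 * (N * (2 * real k + 1) - real k * (real k + 1))"
    unfolding W1 lin by (simp add: field_simps)
  also have "N * (2 * real k + 1) - real k * (real k + 1)
      = real n * (2 * real k + 1) - (3 * real k + 1) * (real k + 1)"
    by (simp add: N_def algebra_simps)
  also have "2 * real k * N - real k * (real k + 1) = 2 * real n * real k - 3 * real k * (real k + 1)"
    by (simp add: N_def algebra_simps)
  finally show ?thesis by (simp only: N_def)
qed

lemma tendsto_affine_over_n:
  fixes f :: "nat \<Rightarrow> real"
  assumes "eventually (\<lambda>n. f n = \<alpha> * real n + \<beta>) sequentially"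
  shows "(\<lambda>n. f n / real n) \<longlonglongrightarrow> \<alpha>"
proof -
  have "(\<lambda>n. \<alpha> + \<beta> * inverse (real n)) \<longlonglongrightarrow> \<alpha> + \<beta> * 0"
    by (intro tendsto_intros lim_inverse_n)
  moreover have "eventually (\<lambda>n. \<alpha> + \<beta> * inverse (real n) = f n / real n) sequentially"
    using assms eventually_gt_at_top[of 0]
    by eventually_elim (simp add: field_simps)
  ultimately show ?thesis by (simp add: tendsto_cong)
qed

theorem theorem4p2:
  fixes a k :: nat and p :: "nat \<Rightarrow> real"
  assumes "prob_vector a p"
    and "\<forall>s\<in>{1..a}. 0 < p s"
  shows "(\<forall>n::nat. 2 * k + 1 \<le> n \<longrightarrow>
      measure_pmf.variance (brt_pmf n a p) (\<lambda>T. real (num_nodes_ge k n T)) =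
        (\<Sum>s=1..a. p s * (\<Sum>r=s..a. p r) ^ k)
          * ((real n - real k - 1) + p 1 * (2 * real n * real k - 3 * real k * (real k + 1)))
        + 2 * (\<Sum>s=2..a. p s * (1 / (\<Sum>u=1..s-1. p u))
            * (\<Sum>r=s..a. p r * (\<Sum>t=r..a. p t) ^ k)
            * (real n - real k - 1
               - (real n - 2 * real k - 1) * (\<Sum>u=s..a. p u) ^ k
               - (1 - (\<Sum>u=s..a. p u) ^ k) / (1 - (\<Sum>u=s..a. p u))))
        - (\<Sum>s=1..a. p s * (\<Sum>r=s..a. p r) ^ k) ^ 2
          * (real n * (2 * real k + 1) - (3 * real k + 1) * (real k + 1)))
    \<and> (\<lambda>n. measure_pmf.variance (brt_pmf n a p) (\<lambda>T. real (num_nodes_ge k n T)) / real n)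
      \<longlonglongrightarrow>
        (\<Sum>s=1..a. p s * (\<Sum>r=s..a. p r) ^ k)
          * (2 * real k * p 1 + 1
             - (2 * real k + 1) * (\<Sum>s=1..a. p s * (\<Sum>r=s..a. p r) ^ k))
        + 2 * (\<Sum>s=2..a. p s / (\<Sum>u=1..s-1. p u)
            * (\<Sum>r=s..a. p r * (\<Sum>t=r..a. p t) ^ k)
            * (1 - (\<Sum>u=s..a. p u) ^ k))"
proof (intro conjI allI impI)
  define q where "q = (\<lambda>s. \<Sum>u=s..a. p u)"
  define T where "T = (\<lambda>s. \<Sum>r=s..a. p r * q r ^ k)"
  let ?V = "\<lambda>n. measure_pmf.variance (brt_pmf n a p) (\<lambda>T. real (num_nodes_ge k n T))"
  show "?V n =
        (\<Sum>s=1..a. p s * (\<Sum>r=s..a. p r) ^ k)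
          * ((real n - real k - 1) + p 1 * (2 * real n * real k - 3 * real k * (real k + 1)))
        + 2 * (\<Sum>s=2..a. p s * (1 / (\<Sum>u=1..s-1. p u))
            * (\<Sum>r=s..a. p r * (\<Sum>t=r..a. p t) ^ k)
            * (real n - real k - 1
               - (real n - 2 * real k - 1) * (\<Sum>u=s..a. p u) ^ k
               - (1 - (\<Sum>u=s..a. p u) ^ k) / (1 - (\<Sum>u=s..a. p u))))
        - (\<Sum>s=1..a. p s * (\<Sum>r=s..a. p r) ^ k) ^ 2
          * (real n * (2 * real k + 1) - (3 * real k + 1) * (real k + 1))"
    if "2 * k + 1 \<le> n" for n
    by (rule variance_brt_closed_form[OF assms that])
  let ?c = "\<lambda>s. p s / (\<Sum>u=1..s-1. p u) * T s"
  \<comment> \<open>the constant term of the variance as an affine function of \<open>n\<close>\<close>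
  define \<beta> where "\<beta> = T 1 * (- real k - 1 - p 1 * (3 * real k * (real k + 1)))
      + 2 * (\<Sum>s=2..a. ?c s * (- real k - 1 + (2 * real k + 1) * q s ^ k
               - (1 - q s ^ k) / (1 - q s)))
      + (T 1)\<^sup>2 * ((3 * real k + 1) * (real k + 1))"
  have "?V n = (T 1 * (2 * real k * p 1 + 1 - (2 * real k + 1) * T 1)
       + 2 * (\<Sum>s=2..a. ?c s * (1 - q s ^ k))) * real n + \<beta>" if "2 * k + 1 \<le> n" for n
  proof -
    have split: "c * (real n - real k - 1 - (real n - 2 * real k - 1) * w - z)
        = c * (1 - w) * real n + c * (- real k - 1 + (2 * real k + 1) * w - z)" for c w z
      by (simp add: algebra_simps)
    have "(\<Sum>s=2..a. p s * (1 / (\<Sum>u=1..s-1. p u)) * T s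
          * (real n - real k - 1 - (real n - 2 * real k - 1) * q s ^ k
             - (1 - q s ^ k) / (1 - q s)))
        = (\<Sum>s=2..a. ?c s * (1 - q s ^ k) * real n + ?c s *
            (- real k - 1 + (2 * real k + 1) * q s ^ k - (1 - q s ^ k) / (1 - q s)))"
      by (intro sum.cong refl) (simp only: split[symmetric] times_divide_eq_right mult_1_right)
    also have "\<dots> = (\<Sum>s=2..a. ?c s * (1 - q s ^ k)) * real n + (\<Sum>s=2..a. ?c s *
            (- real k - 1 + (2 * real k + 1) * q s ^ k - (1 - q s ^ k) / (1 - q s)))"
      by (simp only: sum.distrib sum_distrib_right)
    finally have X: "(\<Sum>s=2..a. p s * (1 / (\<Sum>u=1..s-1. p u)) * T s
          * (real n - real k - 1 - (real n - 2 * real k - 1) * q s ^ k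
             - (1 - q s ^ k) / (1 - q s))) = \<dots>" .
    have collect: "t * ((real n - real k - 1)
            + p 1 * (2 * real n * real k - 3 * real k * (real k + 1)))
          + 2 * (x * real n + y)
          - t\<^sup>2 * (real n * (2 * real k + 1) - (3 * real k + 1) * (real k + 1))
        = (t * (2 * real k * p 1 + 1 - (2 * real k + 1) * t) + 2 * x) * real n
          + (t * (- real k - 1 - p 1 * (3 * real k * (real k + 1))) + 2 * y
             + t\<^sup>2 * ((3 * real k + 1) * (real k + 1)))" for t x y :: real
      by (simp add: algebra_simps power2_eq_square)
    have "?V n = T 1 * ((real n - real k - 1)
            + p 1 * (2 * real n * real k - 3 * real k * (real k + 1)))
          + 2 * (\<Sum>s=2..a. p s * (1 / (\<Sum>u=1..s-1. p u)) * T s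
              * (real n - real k - 1 - (real n - 2 * real k - 1) * q s ^ k
                 - (1 - q s ^ k) / (1 - q s)))
          - (T 1)\<^sup>2 * (real n * (2 * real k + 1) - (3 * real k + 1) * (real k + 1))"
      unfolding T_def q_def by (rule variance_brt_closed_form[OF assms that])
    thus ?thesis unfolding X collect \<beta>_def .
  qed
  hence "eventually (\<lambda>n. ?V n = (T 1 * (2 * real k * p 1 + 1 - (2 * real k + 1) * T 1)
       + 2 * (\<Sum>s=2..a. ?c s * (1 - q s ^ k))) * real n + \<beta>) sequentially"
    by (intro eventually_sequentiallyI[of "2 * k + 1"])
  from tendsto_affine_over_n[OF this]
  show "(\<lambda>n. ?V n / real n) \<longlonglongrightarrow>
        (\<Sum>s=1..a. p s * (\<Sum>r=s..a. p r) ^ k)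
          * (2 * real k * p 1 + 1
             - (2 * real k + 1) * (\<Sum>s=1..a. p s * (\<Sum>r=s..a. p r) ^ k))
        + 2 * (\<Sum>s=2..a. p s / (\<Sum>u=1..s-1. p u)
            * (\<Sum>r=s..a. p r * (\<Sum>t=r..a. p t) ^ k)
            * (1 - (\<Sum>u=s..a. p u) ^ k))"
    by (simp only: T_def q_def)
qed

end
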